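(* Let $(Y_i)_{i\ge1}$ be independent random variables from one of the five non-Gaussian natural exponential families with quadratic variance function (NEF-QVF) described in the context (the same family for all $i$), and assume the condition corresponding to that family: - Binomial: $n_i\ge2$ for all $i$. - Poisson: $\inf_i\tau_i>0$, $\inf_i(\tau_i\theta_i)>0$, and $\sum_{i=1}^p\theta_i^3=O(p)$. - Negative-binomial: $\inf_i(n_ip_i)>0$ and $\sum_{i=1}^p\left(\frac{p_i}{1-p_i}\right)^4=O(p)$. - Gamma: $\inf_i\tau_i>0$ and $\sum_{i=1}^p\lambda_i^4=O(p)$. - GHS: $\inf_i\tau_i>0$ and $\sum_{i=1}^p\lambda_i^4=O(p)$. For each $p$ let $\hat{\boldsymbol\theta}^{\mathrm{PG}}$ be the parametric URE grand-mean shrinkage estimator, and let $\hat{\boldsymbol\theta}^{\hat\gamma,\bar Y}$, $\hat\theta_i^{\hat\gamma,\bar Y}=\frac{\tau_i}{\tau_i+\hat\gamma}Y_i+\frac{\hat\gamma}{\tau_i+\hat\gamma}\bar Y$, be any estimator with (random) $\hat\gamma\ge0$. Then for any $\varepsilon>0$ $$\lim_{p\to\infty}P\left(l_p(\boldsymbol\theta,\hat{\boldsymbol\theta}^{\mathrm{PG}})\ge l_p(\boldsymbol\theta,\hat{\boldsymbol\theta}^{\hat\gamma,\bar Y})+\varepsilon\right)=0$$ and $$\limsup_{p\to\infty}\left[R_p(\boldsymbol\theta,\hat{\boldsymbol\theta}^{\mathrm{PG}})-R_p(\boldsymbol\theta,\hat{\boldsymbol\theta}^{\hat\gamma,\bar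 Y})\right]\le0.$$
   Context: Families (in each case $E(Y_i)=\theta_i$ and $\mathrm{Var}(Y_i)=V(\theta_i)/\tau_i$ with $V(\theta)=\nu_0+\nu_1\theta+\nu_2\theta^2$; all parameters are deterministic sequences; $\tau_i>0$ known): - Binomial: $n_iY_i\sim\mathrm{Bin}(n_i,p_i)$, $n_i$ a positive integer, $p_i\in(0,1)$; $\tau_i=n_i$, $\theta_i=p_i$, $(\nu_0,\nu_1,\nu_2)=(0,1,-1)$. - Poisson: $\tau_iY_i\sim\mathrm{Poisson}(\tau_i\theta_i)$, $\theta_i>0$; $(\nu_0,\nu_1,\nu_2)=(0,1,0)$. - Negative-binomial: $n_iY_i\sim\mathrm{NBin}(n_i,p_i)$, i.e. $P(n_iY_i=k)=\binom{n_i+k-1}{k}p_i^k(1-p_i)^{n_i}$, $k=0,1,2,\dots$, $n_i$ a positive integer, $p_i\in(0,1)$; $\tau_i=n_i$, $\theta_i=\frac{p_i}{1-p_i}$, $(\nu_0,\nu_1,\nu_2)=(0,1,1)$. - Gamma: $\tau_iY_i\sim\Gamma(\tau_i\alpha,\lambda_i)$ (shape $\tau_i\alpha$, scale $\lambda_i>0$), $\alpha>0$ a known constant; $\theta_i=\alpha\lambda_i$, $(\nu_0,\nu_1,\nu_2)=(0,0,1/\alpha)$. - GHS (generalized hyperbolic secant): $\tau_iY_i\sim\mathrm{GHS}(\tau_i\alpha,\lambda_i)$, $\alpha>0$ a known constant, $\lambda_i\in\mathbb R$, where $\mathrm{GHS}(r,\lambda)$ is the law of $X$ with $E e^{sX}=\left(\frac{\cos\eta}{\cos(\eta+s)}\right)^r$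 for $|\eta+s|<\pi/2$, $\eta=\arctan\lambda$ (mean $r\lambda$, variance $r(1+\lambda^2)$); $\theta_i=\alpha\lambda_i$, $(\nu_0,\nu_1,\nu_2)=(\alpha,0,1/\alpha)$. For each $p$: $\bar Y=\frac1p\sum_{i=1}^pY_i$; loss and risk $l_p(\boldsymbol\theta,\hat{\boldsymbol\theta})=\frac1p\sum_{i=1}^p(\hat\theta_i-\theta_i)^2$, $R_p=E[l_p]$. $\mathrm{URE}^{\mathrm{PG}}(\gamma)=\frac1p\sum_{i=1}^p\left[\frac{\gamma^2}{(\tau_i+\gamma)^2}(Y_i-\bar Y)^2+\left(1-2\left(1-\tfrac1p\right)\frac{\gamma}{\tau_i+\gamma}\right)\frac{V(Y_i)}{\tau_i+\nu_2}\right]$, with the value at $\gamma=\infty$ given by the limit $\gamma\to\infty$ (likewise $\frac{\tau_i}{\tau_i+\infty}=0$, $\frac{\infty}{\tau_i+\infty}=1$). Parametric URE grand-mean shrinkage estimator: $\hat\theta_i^{\mathrm{PG}}=\frac{\tau_i}{\tau_i+\hat\gamma^{\mathrm{PG}}}Y_i+\frac{\hat\gamma^{\mathrm{PG}}}{\tau_i+\hat\gamma^{\mathrm{PG}}}\bar Y$, where $\hat\gamma^{\mathrm{PG}}$ is a (measurable) minimizer of $\mathrm{URE}^{\mathrm{PG}}(\gamma)$ over $0\le\gamma\le\infty$. All random quantities are measurable. *)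

theory Defs
  imports "HOL-Probability.Probability"
begin

section \<open>The five non-Gaussian natural exponential families with quadratic variance function\<close>

text \<open>The real argument of \<open>GammaFam\<close> and \<open>GHSFam\<close> is the known constant \<open>\<alpha>\<close>.\<close>

datatype nef_qvf = BinomialFam | PoissonFam | NegBinomialFam | GammaFam real | GHSFam real

text \<open>
  Each family is described by \<open>\<tau>\<close> and one further parameter \<open>\<xi>\<close>, namely \<open>p\<close> (binomial,
  negative binomial), \<open>\<theta>\<close> (Poisson), or \<open>\<lambda>\<close> (gamma, GHS); for the binomial and negative binomial
  families \<open>\<tau> = n\<close>.
\<close>

fun family_mean :: "nef_qvf \<Rightarrow> real \<Rightarrow> real" where
  "family_mean BinomialFam p = p"
| "family_mean PoissonFam \<theta> = \<theta>"
| "family_mean NegBinomialFam p = p / (1 - p)"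
| "family_mean (GammaFam \<alpha>) l = \<alpha> * l"
| "family_mean (GHSFam \<alpha>) l = \<alpha> * l"

fun nu0 :: "nef_qvf \<Rightarrow> real" where
  "nu0 BinomialFam = 0"
| "nu0 PoissonFam = 0"
| "nu0 NegBinomialFam = 0"
| "nu0 (GammaFam \<alpha>) = 0"
| "nu0 (GHSFam \<alpha>) = \<alpha>"

fun nu1 :: "nef_qvf \<Rightarrow> real" where
  "nu1 BinomialFam = 1"
| "nu1 PoissonFam = 1"
| "nu1 NegBinomialFam = 1"
| "nu1 (GammaFam \<alpha>) = 0"
| "nu1 (GHSFam \<alpha>) = 0"

fun nu2 :: "nef_qvf \<Rightarrow> real" where
  "nu2 BinomialFam = -1"
| "nu2 PoissonFam = 0"
| "nu2 NegBinomialFam = 1"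
| "nu2 (GammaFam \<alpha>) = 1 / \<alpha>"
| "nu2 (GHSFam \<alpha>) = 1 / \<alpha>"

definition var_fun :: "nef_qvf \<Rightarrow> real \<Rightarrow> real" where
  "var_fun F x = nu0 F + nu1 F * x + nu2 F * x\<^sup>2"

definition has_nat_law :: "'a measure \<Rightarrow> ('a \<Rightarrow> real) \<Rightarrow> nat pmf \<Rightarrow> bool" where
  "has_nat_law M X q \<longleftrightarrow>
     X \<in> borel_measurable M \<and> distr M borel X = distr (measure_pmf q) borel real"

definition gamma_pdf :: "real \<Rightarrow> real \<Rightarrow> real \<Rightarrow> real" where
  "gamma_pdf k l x =
     (if x > 0 then x powr (k - 1) * exp (- x / l) / (Gamma k * l powr k) else 0)"

text \<open>The generalized hyperbolic secant law is given by its moment generating function, which is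
  finite in a neighbourhood of \<open>0\<close> and therefore determines it.\<close>

definition has_GHS_law :: "'a measure \<Rightarrow> ('a \<Rightarrow> real) \<Rightarrow> real \<Rightarrow> real \<Rightarrow> bool" where
  "has_GHS_law M X r l \<longleftrightarrow>
     X \<in> borel_measurable M \<and>
     (\<forall>s. \<bar>arctan l + s\<bar> < pi / 2 \<longrightarrow>
        has_bochner_integral M (\<lambda>\<omega>. exp (s * X \<omega>))
          ((cos (arctan l) / cos (arctan l + s)) powr r))"

text \<open>
  The law of a single observation \<open>Y\<close>, specified through \<open>\<tau> Y\<close>. The library's \<open>neg_binomial_pmf n q\<close>
  has success probability \<open>q\<close> and counts failures, so \<open>NBin(n, p)\<close> is \<open>neg_binomial_pmf n (1 - p)\<close>;
  see the lemma \<open>pmf_NBin\<close> below.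
\<close>

fun nef_obs :: "nef_qvf \<Rightarrow> 'a measure \<Rightarrow> real \<Rightarrow> real \<Rightarrow> ('a \<Rightarrow> real) \<Rightarrow> bool" where
  "nef_obs BinomialFam M \<tau> p Y \<longleftrightarrow>
     0 < p \<and> p < 1 \<and>
     (\<exists>n::nat. n \<ge> 1 \<and> \<tau> = real n \<and> has_nat_law M (\<lambda>\<omega>. \<tau> * Y \<omega>) (binomial_pmf n p))"
| "nef_obs PoissonFam M \<tau> \<theta> Y \<longleftrightarrow>
     \<tau> > 0 \<and> \<theta> > 0 \<and> has_nat_law M (\<lambda>\<omega>. \<tau> * Y \<omega>) (poisson_pmf (\<tau> * \<theta>))"
| "nef_obs NegBinomialFam M \<tau> p Y \<longleftrightarrow>
     0 < p \<and> p < 1 \<and>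
     (\<exists>n::nat. n \<ge> 1 \<and> \<tau> = real n \<and> has_nat_law M (\<lambda>\<omega>. \<tau> * Y \<omega>) (neg_binomial_pmf n (1 - p)))"
| "nef_obs (GammaFam \<alpha>) M \<tau> l Y \<longleftrightarrow>
     \<alpha> > 0 \<and> \<tau> > 0 \<and> l > 0 \<and>
     distributed M lborel (\<lambda>\<omega>. \<tau> * Y \<omega>) (\<lambda>x. ennreal (gamma_pdf (\<tau> * \<alpha>) l x))"
| "nef_obs (GHSFam \<alpha>) M \<tau> l Y \<longleftrightarrow>
     \<alpha> > 0 \<and> \<tau> > 0 \<and> has_GHS_law M (\<lambda>\<omega>. \<tau> * Y \<omega>) (\<tau> * \<alpha>) l"

lemma pmf_NBin:
  assumes "0 < p" "p < 1" "n \<ge> 1"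
  shows "pmf (neg_binomial_pmf n (1 - p)) k = real ((n + k - 1) choose k) * p ^ k * (1 - p) ^ n"
  using assms by (simp add: pmf_neg_binomial add.commute)

text \<open>The family-specific assumptions on the parameter sequences, indexed by \<open>i \<ge> 1\<close>.\<close>

fun nef_regular :: "nef_qvf \<Rightarrow> (nat \<Rightarrow> real) \<Rightarrow> (nat \<Rightarrow> real) \<Rightarrow> bool" where
  "nef_regular BinomialFam \<tau> p \<longleftrightarrow> (\<forall>i\<ge>1. \<tau> i \<ge> 2)"
| "nef_regular PoissonFam \<tau> \<theta> \<longleftrightarrow>
     (INF i\<in>{1..}. \<tau> i) > 0 \<and> (INF i\<in>{1..}. \<tau> i * \<theta> i) > 0 \<and>
     (\<lambda>p. \<Sum>i=1..p. (\<theta> i) ^ 3) \<in> O(\<lambda>p. real p)"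
| "nef_regular NegBinomialFam \<tau> q \<longleftrightarrow>
     (INF i\<in>{1..}. \<tau> i * q i) > 0 \<and>
     (\<lambda>p. \<Sum>i=1..p. (q i / (1 - q i)) ^ 4) \<in> O(\<lambda>p. real p)"
| "nef_regular (GammaFam \<alpha>) \<tau> l \<longleftrightarrow>
     (INF i\<in>{1..}. \<tau> i) > 0 \<and> (\<lambda>p. \<Sum>i=1..p. (l i) ^ 4) \<in> O(\<lambda>p. real p)"
| "nef_regular (GHSFam \<alpha>) \<tau> l \<longleftrightarrow>
     (INF i\<in>{1..}. \<tau> i) > 0 \<and> (\<lambda>p. \<Sum>i=1..p. (l i) ^ 4) \<in> O(\<lambda>p. real p)"

section \<open>Grand-mean shrinkage\<close>

text \<open>The shrinkage parameter ranges over \<open>[0, \<infinity>]\<close>, i.e. over \<open>ennreal\<close>. The weights at \<open>\<infinity>\<close> are set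
  explicitly because \<open>\<infinity> / \<infinity> = 0\<close> in \<open>ennreal\<close>.\<close>

definition obs_weight :: "real \<Rightarrow> ennreal \<Rightarrow> real" where
  "obs_weight t g = (if g = \<infinity> then 0 else t / (t + enn2real g))"

definition mean_weight :: "real \<Rightarrow> ennreal \<Rightarrow> real" where
  "mean_weight t g = (if g = \<infinity> then 1 else enn2real g / (t + enn2real g))"

definition grand_mean :: "nat \<Rightarrow> (nat \<Rightarrow> real) \<Rightarrow> real" where
  "grand_mean p y = (\<Sum>i=1..p. y i) / real p"

definition shrink_gm :: "(nat \<Rightarrow> real) \<Rightarrow> nat \<Rightarrow> ennreal \<Rightarrow> (nat \<Rightarrow> real) \<Rightarrow> nat \<Rightarrow> real" where
  "shrink_gm \<tau> p g y i = obs_weight (\<tau> i) g * y i + mean_weight (\<tau> i) g * grand_mean p y"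

definition sq_loss :: "nat \<Rightarrow> (nat \<Rightarrow> real) \<Rightarrow> (nat \<Rightarrow> real) \<Rightarrow> real" where
  "sq_loss p \<theta> d = (\<Sum>i=1..p. (d i - \<theta> i)\<^sup>2) / real p"

definition sq_risk :: "'a measure \<Rightarrow> nat \<Rightarrow> (nat \<Rightarrow> real) \<Rightarrow> ('a \<Rightarrow> nat \<Rightarrow> real) \<Rightarrow> real" where
  "sq_risk M p \<theta> D = (\<integral>\<omega>. sq_loss p \<theta> (D \<omega>) \<partial>M)"

definition URE_PG :: "nef_qvf \<Rightarrow> (nat \<Rightarrow> real) \<Rightarrow> nat \<Rightarrow> (nat \<Rightarrow> real) \<Rightarrow> ennreal \<Rightarrow> real" where
  "URE_PG F \<tau> p y g =
     (\<Sum>i=1..p. (mean_weight (\<tau> i) g)\<^sup>2 * (y i - grand_mean p y)\<^sup>2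
        + (1 - 2 * (1 - 1 / real p) * mean_weight (\<tau> i) g) * (var_fun F (y i) / (\<tau> i + nu2 F)))
     / real p"

lemma URE_PG_finite:
  assumes "g \<ge> 0"
  shows "URE_PG F \<tau> p y (ennreal g) =
     1 / real p * (\<Sum>i=1..p. g\<^sup>2 / (\<tau> i + g)\<^sup>2 * (y i - grand_mean p y)\<^sup>2
        + (1 - 2 * (1 - 1 / real p) * (g / (\<tau> i + g))) * (var_fun F (y i) / (\<tau> i + nu2 F)))"
  using assms by (simp add: URE_PG_def mean_weight_def power_divide)

lemma mean_weight_tendsto: "((\<lambda>g. mean_weight t (ennreal g)) \<longlongrightarrow> mean_weight t \<infinity>) at_top"
proof -
  have lim: "((\<lambda>g::real. g / (t + g)) \<longlongrightarrow> 1) at_top"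
  proof (rule Lim_transform_eventually)
    have "((\<lambda>g::real. t / (t + g)) \<longlongrightarrow> 0) at_top"
      by (intro real_tendsto_divide_at_top[OF tendsto_const]
            filterlim_tendsto_add_at_top[OF tendsto_const filterlim_ident])
    then have "((\<lambda>g::real. 1 - t / (t + g)) \<longlongrightarrow> 1 - 0) at_top"
      by (intro tendsto_diff tendsto_const)
    then show "((\<lambda>g::real. 1 - t / (t + g)) \<longlongrightarrow> 1) at_top" by simp
    show "\<forall>\<^sub>F g in at_top. 1 - t / (t + g) = g / (t + g)"
      using eventually_gt_at_top[of "- t"] by eventually_elim (simp add: field_simps)
  qed
  have "\<forall>\<^sub>F g in at_top. g / (t + g) = mean_weight t (ennreal g)"
    using eventually_ge_at_top[of 0] by eventually_elim (simp add: mean_weight_def)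
  with lim show ?thesis
    by (simp add: mean_weight_def Lim_transform_eventually)
qed

lemma URE_PG_infinity: "((\<lambda>g. URE_PG F \<tau> p y (ennreal g)) \<longlongrightarrow> URE_PG F \<tau> p y \<infinity>) at_top"
  unfolding URE_PG_def divide_inverse[of _ "real p"]
  by (intro tendsto_intros mean_weight_tendsto)

end

theory Submission
  imports Defs
begin

text \<open>
  The idea is that the unbiased risk estimate approximates the loss uniformly in the shrinkage
  parameter. If \<open>\<bar>URE_PG F \<tau> p y g - loss g\<bar> \<le> D p\<close> for all \<open>g\<close> in \<open>[0, \<infinity>]\<close>, then a minimizer of the
  risk estimate has a loss of at most \<open>2 * D p\<close> above that of any competitor, including random ones.
  When the expectation of \<open>D p\<close> tends to \<open>0\<close>, Markov's inequality gives the statement about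
  probabilities, and integration gives the one about risks.

  The parameter \<open>g\<close> enters only through the weights \<open>w i = g / (\<tau> i + g)\<close>. Writing \<open>Z i = Y i - \<theta> i\<close>,
  \<open>v i = V (Y i) / (\<tau> i + \<nu>\<^sub>2)\<close>, and \<open>m\<close> for the grand mean, one finds
  that \<open>p\<close> times the difference between risk estimate and loss is
  \<open>\<Sum> (v i - (Z i)\<^sup>2) + 2 * \<Sum> w i * (Z i * Y i - v i) - 2 * m * \<Sum> w i * Z i + 2 / p * \<Sum> w i * v i\<close>
  (lemma \<open>URE_minus_loss\<close>). The summands of the first three sums are independent and centred, since
  \<open>v i\<close> is an unbiased estimate of the variance of \<open>Y i\<close>. For every \<open>g\<close> the weights are a decreasing
  function of \<open>\<tau>\<close> with values in \<open>[0, 1]\<close>; by Abel summation a weighted sum is therefore at most the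
  maximum of the partial sums, taken in the order of increasing \<open>\<tau>\<close>. Doob's maximal inequality
  bounds that maximum in \<open>L\<^sup>2\<close> (\<open>antimono_weighted_sums_envelope\<close>). Altogether the expectation of
  \<open>D p\<close> tends to \<open>0\<close> as soon as the sum of the fourth moments of \<open>Y 1, \<dots>, Y p\<close> is of smaller order
  than \<open>p\<^sup>2\<close> (\<open>URE_uniformly_close_to_loss\<close>).

  All five families are treated through their cumulant function, the logarithm of the moment
  generating function of \<open>\<tau> * Y\<close>. Its first two derivatives at \<open>0\<close> give mean and variance, and the size
  of the neighbourhood of \<open>0\<close> on which it is at most \<open>1\<close> shows that the fourth moment of \<open>Y i\<close> is
  at most a constant times \<open>(1 + \<bar>\<theta> i\<bar>)\<^sup>4\<close> (\<open>moments_from_cumulant_function\<close>). The regularity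
  conditions imply that the sum of \<open>(1 + \<bar>\<theta> i\<bar>)\<^sup>3\<close> over \<open>i \<le> p\<close> is of order \<open>p\<close>; the sum of the
  fourth powers is then at most of order \<open>p\<close> to the power \<open>4 / 3\<close> (\<open>sum_fourth_powers_small\<close>).
\<close>

section \<open>Weighted sums with monotone weights and a maximal inequality\<close>

text \<open>The maximum of the partial sums of \<open>x 0, \<dots>, x (n - 1)\<close>, the empty sum included; hence it is nonnegative.\<close>
primrec prefix_max :: "(nat \<Rightarrow> real) \<Rightarrow> nat \<Rightarrow> real" where
  "prefix_max x 0 = 0"
| "prefix_max x (Suc n) = max (prefix_max x n) (\<Sum>i<Suc n. x i)"

lemma prefix_max_nonneg: "0 \<le> prefix_max x n"
  by (induction n) auto

lemma prefix_sum_le_prefix_max: "(\<Sum>i<n. x i) \<le> prefix_max x n"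
  by (cases n) auto

lemma prefix_max_cong: "(\<And>i. i < n \<Longrightarrow> x i = y i) \<Longrightarrow> prefix_max x n = prefix_max y n"
proof (induction n)
  case (Suc n)
  have "prefix_max x n = prefix_max y n" using Suc by simp
  moreover have "(\<Sum>i<Suc n. x i) = (\<Sum>i<Suc n. y i)" using Suc.prems by (intro sum.cong) auto
  ultimately show ?case by simp
qed simp

text \<open>Abel summation: a sum with weights decreasing from at most \<open>1\<close> to at least \<open>0\<close> is a subconvex
  combination of partial sums. This is what removes the shrinkage parameter from the problem: the
  bound does not depend on the weights.\<close>
lemma antimono_weighted_sum_le_prefix_max:
  assumes "\<And>i. 0 \<le> w i" "\<And>i. w i \<le> 1" "\<And>i. w (Suc i) \<le> w i"
  shows "(\<Sum>i<n. w i * x i) \<le> prefix_max x n"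
proof -
  \<comment> \<open>The induction needs the weight \<open>w n\<close> that is still to come to be carried by the full partial sum.\<close>
  have "(\<Sum>i<n. w i * x i) \<le> (1 - w n) * prefix_max x n + w n * (\<Sum>i<n. x i)"
  proof (induction n)
    case (Suc n)
    let ?m = "prefix_max x (Suc n)" and ?S = "\<Sum>i<Suc n. x i"
    have "(\<Sum>i<Suc n. w i * x i) \<le> (1 - w n) * prefix_max x n + w n * ?S"
      using Suc by (simp add: algebra_simps)
    also have "\<dots> \<le> (1 - w n) * ?m + w n * ?S"
      using assms(2)[of n] by (intro add_right_mono mult_left_mono) auto
    also have "\<dots> = (1 - w (Suc n)) * ?m + w (Suc n) * ?S - (w n - w (Suc n)) * (?m - ?S)"
      by (simp add: algebra_simps)
    also have "\<dots> \<le> (1 - w (Suc n)) * ?m + w (Suc n) * ?S"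
      using mult_nonneg_nonneg[of "w n - w (Suc n)" "?m - ?S"] assms(3)[of n]
        prefix_sum_le_prefix_max[of x "Suc n"] by simp
    finally show ?case .
  qed simp
  also have "\<dots> \<le> (1 - w n) * prefix_max x n + w n * prefix_max x n"
    using assms(1)[of n] prefix_sum_le_prefix_max by (intro add_left_mono mult_left_mono) auto
  finally show ?thesis by (simp add: algebra_simps)
qed

text \<open>The deterministic inequality behind Doob's maximal inequality. The last sum is a discrete
  stochastic integral: for independent centred summands its expectation vanishes, because
  \<open>prefix_max x k\<close> depends only on the terms before \<open>x k\<close>. When a step sets a new record
  the new maximum equals the new partial sum and the step follows from \<open>2 m S \<le> m\<^sup>2 + S\<^sup>2\<close>.\<close>
lemma prefix_max_pathwise:
  "(prefix_max x n)\<^sup>2 \<le> 2 * prefix_max x n * (\<Sum>i<n. x i) - 2 * (\<Sum>k<n. prefix_max x k * x k)"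
proof (induction n)
  case (Suc n)
  let ?m = "prefix_max x n" and ?S = "\<Sum>i<n. x i" and ?T = "\<Sum>k<n. prefix_max x k * x k"
  show ?case
  proof (cases "?S + x n \<le> ?m")
    case True
    then have "prefix_max x (Suc n) = ?m" by simp
    with Suc show ?thesis by (simp add: algebra_simps)
  next
    case False
    then have m: "prefix_max x (Suc n) = ?S + x n" by simp
    have "2 * ?T + 2 * ?m * x n \<le> 2 * ?m * (?S + x n) - ?m\<^sup>2"
      using Suc by (simp add: algebra_simps)
    also have "\<dots> \<le> (?S + x n)\<^sup>2"
      using zero_le_power2[of "?S + x n - ?m"] by (simp add: power2_diff algebra_simps)
    finally show ?thesis unfolding m by (simp add: power2_eq_square algebra_simps)
  qed
qed simp

text \<open>Measurability as a function of the first \<open>N\<close> coordinates alone, which is the form that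
  independence of \<open>prefix_max\<close> from the next summand requires.\<close>
lemma prefix_max_measurable_PiM:
  "n \<le> N \<Longrightarrow> (\<lambda>x. prefix_max x n) \<in> borel_measurable (PiM {..<N} (\<lambda>_. borel))"
proof (induction n)
  case (Suc n)
  then have [measurable]: "(\<lambda>x. prefix_max x n) \<in> borel_measurable (PiM {..<N} (\<lambda>_. borel))" by simp
  have [measurable]: "(\<lambda>x. x i) \<in> borel_measurable (PiM {..<N} (\<lambda>_. borel))" if "i \<in> {..<Suc n}" for i
    using that Suc.prems by (intro measurable_component_singleton) auto
  show ?case unfolding prefix_max.simps by measurable
qed simp

lemma prefix_max_measurable [measurable (raw)]:
  assumes "\<And>i. i < n \<Longrightarrow> X i \<in> borel_measurable M"
  shows "(\<lambda>\<omega>. prefix_max (\<lambda>i. X i \<omega>) n) \<in> borel_measurable M"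
  using assms
proof (induction n)
  case (Suc n)
  then have [measurable]: "(\<lambda>\<omega>. prefix_max (\<lambda>i. X i \<omega>) n) \<in> borel_measurable M" by simp
  have [measurable]: "X i \<in> borel_measurable M" if "i \<in> {..<Suc n}" for i using that Suc.prems by auto
  show ?case unfolding prefix_max.simps by measurable
qed simp

lemma integrable_mult_of_squares:
  fixes f g :: "'a \<Rightarrow> real"
  assumes [measurable]: "f \<in> borel_measurable M" "g \<in> borel_measurable M"
    and "integrable M (\<lambda>x. (f x)\<^sup>2)" "integrable M (\<lambda>x. (g x)\<^sup>2)"
  shows "integrable M (\<lambda>x. f x * g x)"
proof (rule Bochner_Integration.integrable_bound)
  show "integrable M (\<lambda>x. (f x)\<^sup>2 + (g x)\<^sup>2)" using assms by simp
  have "\<bar>f x * g x\<bar> \<le> (f x)\<^sup>2 + (g x)\<^sup>2" for x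
  proof -
    have "0 \<le> \<bar>f x\<bar> * \<bar>g x\<bar>" by simp
    moreover have "2 * (\<bar>f x\<bar> * \<bar>g x\<bar>) \<le> (f x)\<^sup>2 + (g x)\<^sup>2"
      using sum_squares_bound[of "\<bar>f x\<bar>" "\<bar>g x\<bar>"] by (simp add: mult.assoc)
    ultimately show ?thesis unfolding abs_mult by linarith
  qed
  then show "AE x in M. norm (f x * g x) \<le> norm ((f x)\<^sup>2 + (g x)\<^sup>2)" by simp
qed measurable

lemma integrable_square_add:
  fixes f g :: "'a \<Rightarrow> real"
  assumes "f \<in> borel_measurable M" "g \<in> borel_measurable M"
    and "integrable M (\<lambda>x. (f x)\<^sup>2)" "integrable M (\<lambda>x. (g x)\<^sup>2)"
  shows "integrable M (\<lambda>x. (f x + g x)\<^sup>2)"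
  using integrable_mult_of_squares[OF assms] assms(3,4) by (simp add: power2_sum mult.assoc)

lemma integrable_square_sum:
  fixes X :: "'i \<Rightarrow> 'a \<Rightarrow> real"
  assumes "finite I" "\<And>i. i \<in> I \<Longrightarrow> X i \<in> borel_measurable M"
    and "\<And>i. i \<in> I \<Longrightarrow> integrable M (\<lambda>x. (X i x)\<^sup>2)"
  shows "integrable M (\<lambda>x. (\<Sum>i\<in>I. X i x)\<^sup>2)"
  using assms by (induction I) (auto intro!: integrable_square_add borel_measurable_sum)

lemma integrable_square_prefix_max:
  fixes X :: "nat \<Rightarrow> 'a \<Rightarrow> real"
  assumes "\<And>i. i < n \<Longrightarrow> X i \<in> borel_measurable M"
    and "\<And>i. i < n \<Longrightarrow> integrable M (\<lambda>x. (X i x)\<^sup>2)"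
  shows "integrable M (\<lambda>\<omega>. (prefix_max (\<lambda>i. X i \<omega>) n)\<^sup>2)"
  using assms
proof (induction n)
  case (Suc n)
  let ?m = "\<lambda>n \<omega>. prefix_max (\<lambda>i. X i \<omega>) n" and ?S = "\<lambda>\<omega>. \<Sum>i<Suc n. X i \<omega>"
  show ?case
  proof (rule Bochner_Integration.integrable_bound)
    show "integrable M (\<lambda>\<omega>. (?m n \<omega>)\<^sup>2 + (?S \<omega>)\<^sup>2)"
      using Suc by (intro Bochner_Integration.integrable_add integrable_square_sum) auto
    show "(\<lambda>\<omega>. (?m (Suc n) \<omega>)\<^sup>2) \<in> borel_measurable M"
      by (intro borel_measurable_power prefix_max_measurable Suc.prems)
    show "AE \<omega> in M. norm ((?m (Suc n) \<omega>)\<^sup>2) \<le> norm ((?m n \<omega>)\<^sup>2 + (?S \<omega>)\<^sup>2)"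
      by (auto simp: max_def)
  qed
qed simp

context prob_space begin

lemma indep_vars_reindex:
  assumes "indep_vars M' X I" "inj_on f L" "f ` L \<subseteq> I"
  shows "indep_vars (\<lambda>j. M' (f j)) (\<lambda>j. X (f j)) L"
proof -
  have "indep_vars (\<lambda>j. PiM {f j} M') (\<lambda>j \<omega>. restrict (\<lambda>i. X i \<omega>) {f j}) L"
    using assms by (intro indep_vars_restrict[OF assms(1)]) (auto simp: disjoint_family_on_def inj_on_def)
  from indep_vars_compose2[OF this measurable_component_singleton[OF singletonI]]
  show ?thesis by simp
qed

text \<open>Independence in the form in which martingale arguments use it: a function \<open>H\<close> of the past is
  orthogonal to the next centred term.\<close>
lemma indep_mult_expectation_zero:
  fixes X :: "nat \<Rightarrow> 'a \<Rightarrow> real"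
  assumes ind: "indep_vars (\<lambda>_. borel) X {..<n}" and k: "k < n"
    and h: "h \<in> borel_measurable (PiM {..<k} (\<lambda>_. borel :: real measure))"
    and hX: "\<And>\<omega>. h (\<lambda>i\<in>{..<k}. X i \<omega>) = H \<omega>"
    and int: "integrable M H" "integrable M (X k)" and mean: "expectation (X k) = 0"
  shows "expectation (\<lambda>\<omega>. H \<omega> * X k \<omega>) = 0"
proof -
  have "indep_var (PiM {..<k} (\<lambda>_. borel)) (\<lambda>\<omega>. restrict (\<lambda>i. X i \<omega>) {..<k})
      (PiM {k} (\<lambda>_. borel)) (\<lambda>\<omega>. restrict (\<lambda>i. X i \<omega>) {k})"
    using k by (intro indep_var_restrict[OF ind]) auto
  from indep_var_compose[OF this h measurable_component_singleton[of k "{k}" "\<lambda>_. borel"]]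
  have "indep_var borel H borel (X k)" using hX by (simp add: comp_def)
  from indep_var_lebesgue_integral[OF this int] mean show ?thesis by simp
qed

text \<open>Doob's \<open>L\<^sup>2\<close> maximal inequality for partial sums of independent centred variables, obtained by
  taking expectations in the pathwise inequality.\<close>
theorem prefix_max_L2_bound:
  fixes X :: "nat \<Rightarrow> 'a \<Rightarrow> real"
  assumes ind: "indep_vars (\<lambda>_. borel) X {..<n}"
    and sq: "\<And>i. i < n \<Longrightarrow> integrable M (\<lambda>x. (X i x)\<^sup>2)"
    and mean: "\<And>i. i < n \<Longrightarrow> expectation (X i) = 0"
  shows "expectation (\<lambda>\<omega>. (prefix_max (\<lambda>i. X i \<omega>) n)\<^sup>2) \<le> 4 * (\<Sum>i<n. expectation (\<lambda>x. (X i x)\<^sup>2))"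
proof -
  let ?m = "\<lambda>n \<omega>. prefix_max (\<lambda>i. X i \<omega>) n" and ?S = "\<lambda>n \<omega>. \<Sum>i<n. X i \<omega>"
  have rv: "X i \<in> borel_measurable M" if "i < n" for i
    using ind that by (auto simp: indep_vars_def)
  have X1: "integrable M (X i)" if "i < n" for i
    using square_integrable_imp_integrable[OF rv[OF that] sq[OF that]] .
  have m2: "integrable M (\<lambda>\<omega>. (?m k \<omega>)\<^sup>2)" if "k \<le> n" for k
    by (rule integrable_square_prefix_max) (use that rv sq in auto)
  have m1: "integrable M (?m k)" if "k \<le> n" for k
    using square_integrable_imp_integrable[OF _ m2[OF that]] prefix_max_measurable[of k X M] rv that by auto
  have S2: "integrable M (\<lambda>\<omega>. (?S k \<omega>)\<^sup>2)" if "k \<le> n" for k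
    by (rule integrable_square_sum) (use that rv sq in auto)
  have S1: "integrable M (?S k)" if "k \<le> n" for k
    using X1 that by (intro Bochner_Integration.integrable_sum) auto
  have mX: "integrable M (\<lambda>\<omega>. ?m k \<omega> * X k \<omega>)" if "k < n" for k
    using that rv by (intro integrable_mult_of_squares m2 sq prefix_max_measurable) auto
  have mX0: "expectation (\<lambda>\<omega>. ?m k \<omega> * X k \<omega>) = 0" if k: "k < n" for k
    by (rule indep_mult_expectation_zero[OF ind k prefix_max_measurable_PiM[OF order_refl] _ m1 X1 mean])
      (use k in \<open>auto intro!: prefix_max_cong\<close>)
  have S_var: "expectation (\<lambda>\<omega>. (?S k \<omega>)\<^sup>2) = (\<Sum>i<k. expectation (\<lambda>x. (X i x)\<^sup>2))" if "k \<le> n" for k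
    using that
  proof (induction k)
    case (Suc k)
    have SX0: "expectation (\<lambda>\<omega>. ?S k \<omega> * X k \<omega>) = 0"
    proof (rule indep_mult_expectation_zero[OF ind _ _ _ S1 X1 mean])
      show "(\<lambda>x. \<Sum>i<k. x i) \<in> borel_measurable (PiM {..<k} (\<lambda>_. borel :: real measure))"
        by (rule borel_measurable_sum[of _ "\<lambda>i x. x i"]) (rule measurable_component_singleton)
    qed (use Suc in auto)
    have SX: "integrable M (\<lambda>\<omega>. ?S k \<omega> * X k \<omega>)"
      using Suc.prems rv by (intro integrable_mult_of_squares S2 sq borel_measurable_sum) auto
    have "expectation (\<lambda>\<omega>. (?S (Suc k) \<omega>)\<^sup>2)
        = expectation (\<lambda>\<omega>. (?S k \<omega>)\<^sup>2 + (X k \<omega>)\<^sup>2 + 2 * (?S k \<omega> * X k \<omega>))"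
      by (simp add: power2_sum mult.assoc)
    also have "\<dots> = expectation (\<lambda>\<omega>. (?S k \<omega>)\<^sup>2) + expectation (\<lambda>\<omega>. (X k \<omega>)\<^sup>2)"
      using Suc.prems SX SX0 sq S2 by simp
    finally show ?case using Suc by simp
  qed simp
  have "expectation (\<lambda>\<omega>. (?m n \<omega>)\<^sup>2)
      \<le> expectation (\<lambda>\<omega>. 4 * (?S n \<omega>)\<^sup>2 - 4 * (\<Sum>k<n. ?m k \<omega> * X k \<omega>))"
  proof (rule integral_mono)
    fix \<omega>
    have "(?m n \<omega>)\<^sup>2 \<le> 2 * ?m n \<omega> * ?S n \<omega> - 2 * (\<Sum>k<n. ?m k \<omega> * X k \<omega>)"
      by (rule prefix_max_pathwise)
    \<comment> \<open>\<open>2 m S \<le> m\<^sup>2 / 2 + 2 S\<^sup>2\<close> absorbs half of the left-hand side\<close>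
    moreover have "2 * ?m n \<omega> * ?S n \<omega> \<le> (?m n \<omega>)\<^sup>2 / 2 + 2 * (?S n \<omega>)\<^sup>2"
      using zero_le_power2[of "?m n \<omega> - 2 * ?S n \<omega>"] by (simp add: power2_diff)
    ultimately show "(?m n \<omega>)\<^sup>2 \<le> 4 * (?S n \<omega>)\<^sup>2 - 4 * (\<Sum>k<n. ?m k \<omega> * X k \<omega>)" by linarith
  next
    show "integrable M (\<lambda>\<omega>. 4 * (?S n \<omega>)\<^sup>2 - 4 * (\<Sum>k<n. ?m k \<omega> * X k \<omega>))"
      by (intro Bochner_Integration.integrable_diff integrable_mult_right
          Bochner_Integration.integrable_sum S2 mX) auto
  qed (use m2 in auto)
  also have "\<dots> = expectation (\<lambda>\<omega>. 4 * (?S n \<omega>)\<^sup>2) - expectation (\<lambda>\<omega>. 4 * (\<Sum>k<n. ?m k \<omega> * X k \<omega>))"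
    by (intro Bochner_Integration.integral_diff integrable_mult_right
        Bochner_Integration.integrable_sum S2 mX) auto
  also have "expectation (\<lambda>\<omega>. \<Sum>k<n. ?m k \<omega> * X k \<omega>) = 0"
    by (subst Bochner_Integration.integral_sum) (auto intro: mX simp: mX0)
  then have "expectation (\<lambda>\<omega>. 4 * (\<Sum>k<n. ?m k \<omega> * X k \<omega>)) = 0" by simp
  also have "expectation (\<lambda>\<omega>. 4 * (?S n \<omega>)\<^sup>2) - 0 = 4 * (\<Sum>i<n. expectation (\<lambda>x. (X i x)\<^sup>2))"
    by (simp add: S_var)
  finally show ?thesis .
qed

text \<open>One random variable \<open>G\<close> dominates all sums whose weights decrease in \<open>\<tau>\<close>, at the price of a
  constant factor in the second moment: sort the indices by \<open>\<tau>\<close> and add the maximal functions of the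
  partial sums of \<open>X\<close> and of \<open>- X\<close>.\<close>
theorem antimono_weighted_sums_envelope:
  fixes X :: "nat \<Rightarrow> 'a \<Rightarrow> real" and \<tau> :: "nat \<Rightarrow> real"
  assumes ind: "indep_vars (\<lambda>_. borel) X I" and I: "finite I"
    and sq: "\<And>i. i \<in> I \<Longrightarrow> integrable M (\<lambda>x. (X i x)\<^sup>2)"
    and mean: "\<And>i. i \<in> I \<Longrightarrow> expectation (X i) = 0"
  obtains G where "G \<in> borel_measurable M" "integrable M (\<lambda>\<omega>. (G \<omega>)\<^sup>2)"
    "expectation (\<lambda>\<omega>. (G \<omega>)\<^sup>2) \<le> 16 * (\<Sum>i\<in>I. expectation (\<lambda>x. (X i x)\<^sup>2))"
    "\<And>\<omega>. 0 \<le> G \<omega>"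
    "\<And>w \<omega>. (\<And>i. i \<in> I \<Longrightarrow> 0 \<le> w i \<and> w i \<le> 1) \<Longrightarrow>
       (\<And>i j. i \<in> I \<Longrightarrow> j \<in> I \<Longrightarrow> \<tau> i \<le> \<tau> j \<Longrightarrow> w j \<le> w i) \<Longrightarrow> \<bar>\<Sum>i\<in>I. w i * X i \<omega>\<bar> \<le> G \<omega>"
proof -
  define xs where "xs = sort_key \<tau> (sorted_list_of_set I)"
  define n where "n = length xs"
  have set_xs: "set xs = I" and dist: "distinct xs" and sorted: "sorted (map \<tau> xs)"
    using I by (simp_all add: xs_def)
  have bij: "bij_betw ((!) xs) {..<n} I"
    unfolding n_def by (rule bij_betw_nth) (use dist set_xs in auto)
  have in_I: "xs ! i \<in> I" if "i < n" for i using that set_xs by (auto simp: n_def)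
  have reindex: "(\<Sum>i\<in>I. f i) = (\<Sum>k<n. f (xs ! k))" for f :: "nat \<Rightarrow> real"
    using sum.reindex_bij_betw[OF bij, of f] by simp
  define U where "U k = X (xs ! k)" for k
  have indU: "indep_vars (\<lambda>_. borel) U {..<n}"
    unfolding U_def by (rule indep_vars_reindex[OF indep_vars_subset[OF ind]])
      (use bij in \<open>auto simp: bij_betw_def\<close>)
  have indN: "indep_vars (\<lambda>_. borel) (\<lambda>k \<omega>. - U k \<omega>) {..<n}"
    using indep_vars_compose2[OF indU, of "\<lambda>_ x. - x" "\<lambda>_. borel"] by simp
  have sqU: "integrable M (\<lambda>x. (U k x)\<^sup>2)" and meanU: "expectation (U k) = 0" if "k < n" for k
    using sq mean in_I[OF that] by (auto simp: U_def)
  have rvU: "U k \<in> borel_measurable M" if "k < n" for k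
    using indU that by (auto simp: indep_vars_def)
  define A where "A \<omega> = prefix_max (\<lambda>k. U k \<omega>) n" for \<omega>
  define B where "B \<omega> = prefix_max (\<lambda>k. - U k \<omega>) n" for \<omega>
  have A[measurable]: "A \<in> borel_measurable M" and B[measurable]: "B \<in> borel_measurable M"
    unfolding A_def B_def using rvU by (auto intro!: prefix_max_measurable)
  have A2: "integrable M (\<lambda>\<omega>. (A \<omega>)\<^sup>2)" "expectation (\<lambda>\<omega>. (A \<omega>)\<^sup>2) \<le> 4 * (\<Sum>k<n. expectation (\<lambda>x. (U k x)\<^sup>2))"
    unfolding A_def using prefix_max_L2_bound[OF indU sqU meanU] integrable_square_prefix_max[OF rvU sqU] by auto
  have B2: "integrable M (\<lambda>\<omega>. (B \<omega>)\<^sup>2)" "expectation (\<lambda>\<omega>. (B \<omega>)\<^sup>2) \<le> 4 * (\<Sum>k<n. expectation (\<lambda>x. (U k x)\<^sup>2))"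
    unfolding B_def using prefix_max_L2_bound[OF indN] integrable_square_prefix_max[of n "\<lambda>k \<omega>. - U k \<omega>" M]
      rvU sqU meanU by auto
  show ?thesis
  proof (rule that[of "\<lambda>\<omega>. A \<omega> + B \<omega>"])
    show AB: "integrable M (\<lambda>\<omega>. (A \<omega> + B \<omega>)\<^sup>2)"
      by (intro integrable_square_add A B A2 B2)
    have "expectation (\<lambda>\<omega>. (A \<omega> + B \<omega>)\<^sup>2) \<le> expectation (\<lambda>\<omega>. 2 * (A \<omega>)\<^sup>2 + 2 * (B \<omega>)\<^sup>2)"
    proof (rule integral_mono[OF AB])
      show "(A \<omega> + B \<omega>)\<^sup>2 \<le> 2 * (A \<omega>)\<^sup>2 + 2 * (B \<omega>)\<^sup>2" for \<omega>
        using zero_le_power2[of "A \<omega> - B \<omega>"] by (simp add: power2_sum power2_diff)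
    qed (use A2 B2 in auto)
    also have "\<dots> \<le> 16 * (\<Sum>k<n. expectation (\<lambda>x. (U k x)\<^sup>2))"
      using A2 B2 by simp
    finally show "expectation (\<lambda>\<omega>. (A \<omega> + B \<omega>)\<^sup>2) \<le> 16 * (\<Sum>i\<in>I. expectation (\<lambda>x. (X i x)\<^sup>2))"
      unfolding reindex U_def .
    fix w :: "nat \<Rightarrow> real" and \<omega>
    assume w: "\<And>i. i \<in> I \<Longrightarrow> 0 \<le> w i \<and> w i \<le> 1"
      and anti: "\<And>i j. i \<in> I \<Longrightarrow> j \<in> I \<Longrightarrow> \<tau> i \<le> \<tau> j \<Longrightarrow> w j \<le> w i"
    \<comment> \<open>Extending the sorted weights by \<open>0\<close> keeps the whole sequence decreasing.\<close>
    define v where "v k = (if k < n then w (xs ! k) else 0)" for k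
    have v: "0 \<le> v k" "v k \<le> 1" "v (Suc k) \<le> v k" for k
    proof -
      show "0 \<le> v k" "v k \<le> 1" using w in_I by (auto simp: v_def)
      show "v (Suc k) \<le> v k"
      proof (cases "Suc k < n")
        case True
        then have "\<tau> (xs ! k) \<le> \<tau> (xs ! Suc k)"
          using sorted_nth_mono[OF sorted, of k "Suc k"] by (simp add: n_def)
        then show ?thesis using anti in_I True by (simp add: v_def)
      qed (use w in_I in \<open>auto simp: v_def\<close>)
    qed
    have eq: "(\<Sum>i\<in>I. w i * X i \<omega>) = (\<Sum>k<n. v k * U k \<omega>)"
      unfolding reindex by (intro sum.cong) (auto simp: v_def U_def)
    have "(\<Sum>k<n. v k * U k \<omega>) \<le> A \<omega>"
      unfolding A_def by (rule antimono_weighted_sum_le_prefix_max) (rule v)+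
    moreover have "(\<Sum>k<n. v k * - U k \<omega>) \<le> B \<omega>"
      unfolding B_def by (rule antimono_weighted_sum_le_prefix_max) (rule v)+
    moreover have "0 \<le> A \<omega>" "0 \<le> B \<omega>" by (simp_all add: A_def B_def prefix_max_nonneg)
    ultimately show "\<bar>\<Sum>i\<in>I. w i * X i \<omega>\<bar> \<le> A \<omega> + B \<omega>"
      unfolding eq by (auto simp: sum_negf)
  next
    show "(\<lambda>\<omega>. A \<omega> + B \<omega>) \<in> borel_measurable M" by measurable
    show "0 \<le> A \<omega> + B \<omega>" for \<omega> by (simp add: A_def B_def prefix_max_nonneg)
  qed
qed

end

section \<open>Moments from the cumulant function\<close>

text \<open>A majorant for the difference quotients of \<open>\<lambda>s. exp (s * x)\<close> that is uniform in the increment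
  \<open>u\<close> and consists of exponentials only, so that a moment generating function finite near \<open>0\<close> makes
  it integrable. The factor \<open>\<bar>x\<bar>\<close> of the mean value theorem is absorbed by \<open>\<eta> \<bar>x\<bar> \<le> exp (\<eta> \<bar>x\<bar>)\<close>.\<close>
lemma abs_exp_diff_quotient_bound:
  fixes x u \<eta> :: real
  assumes "0 < \<eta>" "\<bar>u\<bar> \<le> \<eta>" "u \<noteq> 0"
  shows "\<bar>(exp (u * x) - 1) / u\<bar> \<le> (exp (2 * \<eta> * x) + exp (- 2 * \<eta> * x)) / \<eta>"
proof -
  have e1: "\<bar>exp y - 1\<bar> \<le> \<bar>y\<bar> * exp \<bar>y\<bar>" for y :: real
  proof (cases "0 \<le> y")
    case True
    have "1 - y \<le> exp (- y)" using exp_ge_add_one_self[of "- y"] by simp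
    then have "(1 - y) * exp y \<le> 1" by (simp add: exp_minus field_simps)
    with True show ?thesis by (simp add: algebra_simps)
  next
    case False
    have "1 + y \<le> exp y" by (rule exp_ge_add_one_self)
    moreover have "exp y \<le> 1" using False by simp
    moreover have "\<bar>y\<bar> * 1 \<le> \<bar>y\<bar> * exp \<bar>y\<bar>" by (intro mult_left_mono) auto
    ultimately show ?thesis using False by linarith
  qed
  have "\<bar>(exp (u * x) - 1) / u\<bar> \<le> \<bar>u * x\<bar> * exp \<bar>u * x\<bar> / \<bar>u\<bar>"
    unfolding abs_divide by (intro divide_right_mono e1) auto
  also have "\<dots> = \<bar>x\<bar> * exp (\<bar>u\<bar> * \<bar>x\<bar>)" using assms by (simp add: abs_mult)
  also have "\<dots> \<le> \<bar>x\<bar> * exp (\<eta> * \<bar>x\<bar>)" using assms by (intro mult_left_mono) (auto intro: mult_right_mono)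
  also have "\<dots> \<le> (exp (\<eta> * \<bar>x\<bar>) / \<eta>) * exp (\<eta> * \<bar>x\<bar>)"
  proof (rule mult_right_mono)
    have "\<eta> * \<bar>x\<bar> \<le> exp (\<eta> * \<bar>x\<bar>)" using exp_ge_add_one_self[of "\<eta> * \<bar>x\<bar>"] by linarith
    then show "\<bar>x\<bar> \<le> exp (\<eta> * \<bar>x\<bar>) / \<eta>" using assms by (simp add: field_simps)
  qed simp
  also have "\<dots> = exp (2 * \<eta> * \<bar>x\<bar>) / \<eta>" by (simp add: exp_add[symmetric])
  also have "\<dots> \<le> (exp (2 * \<eta> * x) + exp (- 2 * \<eta> * x)) / \<eta>"
    using assms by (intro divide_right_mono) (auto simp: abs_if)
  finally show ?thesis .
qed

text \<open>Differentiation under the integral sign by dominated convergence. The weight \<open>h\<close> is there so that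
  the lemma can be iterated: with \<open>h = 1\<close> it gives the first derivative of the moment generating
  function, and with \<open>h = X\<close> the second.\<close>
lemma has_derivative_weighted_exp_moment:
  fixes X h :: "'a \<Rightarrow> real"
  assumes [measurable]: "X \<in> borel_measurable M" "h \<in> borel_measurable M"
    and int: "\<And>s. \<bar>s\<bar> < d \<Longrightarrow> integrable M (\<lambda>\<omega>. h \<omega> * exp (s * X \<omega>))"
    and s: "\<bar>s\<bar> < d"
  shows "integrable M (\<lambda>\<omega>. h \<omega> * X \<omega> * exp (s * X \<omega>))"
    and "((\<lambda>s. \<integral>\<omega>. h \<omega> * exp (s * X \<omega>) \<partial>M) has_real_derivative
           (\<integral>\<omega>. h \<omega> * X \<omega> * exp (s * X \<omega>) \<partial>M)) (at s)"
proof -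
  \<comment> \<open>The majorant uses the exponents \<open>s + 2 * \<eta>\<close> and \<open>s - 2 * \<eta>\<close>; a third of the distance to the
    boundary keeps both inside.\<close>
  define \<eta> where "\<eta> = (d - \<bar>s\<bar>) / 3"
  have \<eta>: "0 < \<eta>" and d: "\<bar>s + 2 * \<eta>\<bar> < d" "\<bar>s - 2 * \<eta>\<bar> < d" using s unfolding \<eta>_def by (auto simp: field_simps)
  define B where "B \<omega> = (\<bar>h \<omega> * exp ((s + 2 * \<eta>) * X \<omega>)\<bar> + \<bar>h \<omega> * exp ((s - 2 * \<eta>) * X \<omega>)\<bar>) / \<eta>" for \<omega>
  define q where "q u \<omega> = h \<omega> * exp (s * X \<omega>) * ((exp (u * X \<omega>) - 1) / u)" for u \<omega>
  have B: "integrable M B" unfolding B_def using int[OF d(1)] int[OF d(2)] by auto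
  have qB: "\<bar>q u \<omega>\<bar> \<le> B \<omega>" if "\<bar>u\<bar> \<le> \<eta>" "u \<noteq> 0" for u \<omega>
  proof -
    have "\<bar>q u \<omega>\<bar> \<le> \<bar>h \<omega>\<bar> * exp (s * X \<omega>) * ((exp (2 * \<eta> * X \<omega>) + exp (- 2 * \<eta> * X \<omega>)) / \<eta>)"
      unfolding q_def abs_mult[of "h \<omega> * exp (s * X \<omega>)"]
      using abs_exp_diff_quotient_bound[OF \<eta> that] by (intro mult_mono) (auto simp: abs_mult)
    also have "\<dots> = B \<omega>"
    proof -
      have "exp (s * X \<omega>) * exp (2 * \<eta> * X \<omega>) = exp ((s + 2 * \<eta>) * X \<omega>)"
        "exp (s * X \<omega>) * exp (- 2 * \<eta> * X \<omega>) = exp ((s - 2 * \<eta>) * X \<omega>)"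
        by (simp_all add: mult_exp_exp algebra_simps)
      then show ?thesis by (simp add: B_def abs_mult mult.assoc distrib_left flip: add_divide_distrib)
    qed
    finally show ?thesis .
  qed
  have lim_q: "((\<lambda>u. q u \<omega>) \<longlongrightarrow> h \<omega> * X \<omega> * exp (s * X \<omega>)) (at 0)" for \<omega>
  proof -
    have "((\<lambda>u. exp (u * X \<omega>)) has_real_derivative X \<omega>) (at 0)"
      by (auto intro!: derivative_eq_intros)
    then have "((\<lambda>u. (exp (u * X \<omega>) - 1) / u) \<longlongrightarrow> X \<omega>) (at 0)"
      by (simp add: has_field_derivative_iff)
    from tendsto_mult_left[OF this, of "h \<omega> * exp (s * X \<omega>)"] show ?thesis
      unfolding q_def by (simp add: mult_ac)
  qed
  have seq: "integrable M (\<lambda>\<omega>. h \<omega> * X \<omega> * exp (s * X \<omega>)) \<and>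
      (\<lambda>n. \<integral>\<omega>. q (u n) \<omega> \<partial>M) \<longlonglongrightarrow> (\<integral>\<omega>. h \<omega> * X \<omega> * exp (s * X \<omega>) \<partial>M)"
    if u: "\<And>n. \<bar>u n\<bar> \<le> \<eta>" "\<And>n. u n \<noteq> 0" "u \<longlonglongrightarrow> 0" for u :: "nat \<Rightarrow> real"
  proof -
    have fl: "filterlim u (at 0) sequentially" using u by (auto simp: filterlim_at)
    have "AE \<omega> in M. (\<lambda>n. q (u n) \<omega>) \<longlonglongrightarrow> h \<omega> * X \<omega> * exp (s * X \<omega>)"
      using filterlim_compose[OF lim_q fl] by simp
    moreover have "AE \<omega> in M. norm (q (u n) \<omega>) \<le> B \<omega>" for n using qB u by simp
    moreover have "(\<lambda>\<omega>. q (u n) \<omega>) \<in> borel_measurable M" for n unfolding q_def by measurable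
    ultimately show ?thesis
      using integrable_dominated_convergence[OF _ _ B, of "\<lambda>\<omega>. h \<omega> * X \<omega> * exp (s * X \<omega>)" "\<lambda>n. q (u n)"]
        integral_dominated_convergence[OF _ _ B, of "\<lambda>\<omega>. h \<omega> * X \<omega> * exp (s * X \<omega>)" "\<lambda>n. q (u n)"]
      by auto
  qed
  show "integrable M (\<lambda>\<omega>. h \<omega> * X \<omega> * exp (s * X \<omega>))"
  proof -
    have "(\<lambda>n. \<eta> / real (Suc n)) \<longlonglongrightarrow> 0" by (rule LIMSEQ_Suc[OF lim_const_over_n])
    moreover have "\<bar>\<eta> / real (Suc n)\<bar> \<le> \<eta>" for n using \<eta> by (simp add: field_simps)
    ultimately show ?thesis using seq[of "\<lambda>n. \<eta> / real (Suc n)"] \<eta> by auto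
  qed
  have quot: "((\<integral>\<omega>. h \<omega> * exp ((s + u) * X \<omega>) \<partial>M) - (\<integral>\<omega>. h \<omega> * exp (s * X \<omega>) \<partial>M)) / u = (\<integral>\<omega>. q u \<omega> \<partial>M)"
    if "\<bar>u\<bar> \<le> \<eta>" for u
  proof -
    have "\<bar>s + u\<bar> < d" using that s \<eta> unfolding \<eta>_def by (auto simp: field_simps)
    from int[OF this] int[OF s] have "(\<integral>\<omega>. h \<omega> * exp ((s + u) * X \<omega>) \<partial>M) - (\<integral>\<omega>. h \<omega> * exp (s * X \<omega>) \<partial>M)
       = (\<integral>\<omega>. h \<omega> * exp ((s + u) * X \<omega>) - h \<omega> * exp (s * X \<omega>) \<partial>M)" by simp
    also have "\<dots> / u = (\<integral>\<omega>. (h \<omega> * exp ((s + u) * X \<omega>) - h \<omega> * exp (s * X \<omega>)) / u \<partial>M)" by simp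
    also have "\<dots> = (\<integral>\<omega>. q u \<omega> \<partial>M)"
      by (intro Bochner_Integration.integral_cong)
        (auto simp: q_def algebra_simps exp_add diff_divide_distrib)
    finally show ?thesis .
  qed
  show "((\<lambda>s. \<integral>\<omega>. h \<omega> * exp (s * X \<omega>) \<partial>M) has_real_derivative
           (\<integral>\<omega>. h \<omega> * X \<omega> * exp (s * X \<omega>) \<partial>M)) (at s)"
    unfolding DERIV_def tendsto_at_iff_sequentially comp_def
  proof (intro allI impI)
    fix u :: "nat \<Rightarrow> real" assume u: "\<forall>i. u i \<in> UNIV - {0}" "u \<longlonglongrightarrow> 0"
    from u(2) \<eta> have "\<forall>\<^sub>F n in sequentially. dist (u n) 0 < \<eta>" by (rule tendstoD)
    then obtain N where "\<forall>n\<ge>N. \<bar>u n\<bar> < \<eta>" by (auto simp: eventually_sequentially)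
    then have N: "\<bar>u n\<bar> \<le> \<eta>" if "n \<ge> N" for n using that by (simp add: less_imp_le)
    have "(\<lambda>n. \<integral>\<omega>. q (u (n + N)) \<omega> \<partial>M) \<longlonglongrightarrow> (\<integral>\<omega>. h \<omega> * X \<omega> * exp (s * X \<omega>) \<partial>M)"
      using seq[of "\<lambda>n. u (n + N)"] N u LIMSEQ_ignore_initial_segment[OF u(2), of N] by auto
    then have "(\<lambda>n. ((\<integral>\<omega>. h \<omega> * exp ((s + u (n + N)) * X \<omega>) \<partial>M) - (\<integral>\<omega>. h \<omega> * exp (s * X \<omega>) \<partial>M)) / u (n + N))
       \<longlonglongrightarrow> (\<integral>\<omega>. h \<omega> * X \<omega> * exp (s * X \<omega>) \<partial>M)"
      using N by (simp add: quot)
    then show "(\<lambda>n. ((\<integral>\<omega>. h \<omega> * exp ((s + u n) * X \<omega>) \<partial>M) - (\<integral>\<omega>. h \<omega> * exp (s * X \<omega>) \<partial>M)) / u n)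
       \<longlonglongrightarrow> (\<integral>\<omega>. h \<omega> * X \<omega> * exp (s * X \<omega>) \<partial>M)"
      by (rule LIMSEQ_offset)
  qed
qed

lemma fourth_power_le_exp:
  fixes x :: real
  shows "x ^ 4 \<le> 24 * (exp x + exp (- x))"
proof -
  have *: "y ^ 4 \<le> 24 * exp y" if "0 \<le> y" for y :: real
  proof -
    have "(\<Sum>n<5. y ^ n /\<^sub>R fact n) \<le> exp y"
      using summable_exp_generic[of y] that unfolding exp_def by (intro sum_le_suminf) auto
    then have "1 + y + y\<^sup>2 / 2 + y ^ 3 / 6 + y ^ 4 / 24 \<le> exp y"
      by (simp add: numeral_eq_Suc field_simps)
    moreover have "0 \<le> y\<^sup>2" "0 \<le> y ^ 3" using that by simp_all
    ultimately show ?thesis using that by linarith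
  qed
  show ?thesis
  proof (cases "0 \<le> x")
    case True
    then show ?thesis using *[of x] exp_ge_zero[of "- x"] by (simp add: distrib_left add_increasing2)
  next
    case False
    then show ?thesis using *[of "- x"] exp_ge_zero[of x] by (simp add: distrib_left add_increasing)
  qed
qed

text \<open>The first two derivatives of \<open>exp \<circ> K\<close> at \<open>0\<close> are the first two moments. The fourth moment is
  not read off from derivatives: \<open>(d X)\<^sup>4 \<le> 24 (exp (d X) + exp (- d X))\<close>, so a radius \<open>d\<close> on
  which the cumulant function is at most \<open>1\<close> already bounds it, with \<open>144 = 24 * (3 + 3)\<close> coming
  from \<open>exp 1 \<le> 3\<close>.\<close>
theorem moments_from_cumulant_function:
  fixes X :: "'a \<Rightarrow> real" and K K' :: "real \<Rightarrow> real"
  assumes M: "prob_space M" and X[measurable]: "X \<in> borel_measurable M" and d: "0 < d"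
    and mgf: "\<And>s. \<bar>s\<bar> \<le> d \<Longrightarrow> has_bochner_integral M (\<lambda>\<omega>. exp (s * X \<omega>)) (exp (K s))"
    and K1: "\<And>s. \<bar>s\<bar> \<le> d \<Longrightarrow> K s \<le> 1"
    and K': "\<And>s. \<bar>s\<bar> \<le> d \<Longrightarrow> (K has_real_derivative K' s) (at s)"
    and K'': "(K' has_real_derivative v) (at 0)"
  shows "integrable M (\<lambda>\<omega>. (X \<omega>) ^ 4)"
    and "(\<integral>\<omega>. (X \<omega>) ^ 4 \<partial>M) \<le> 144 / d ^ 4"
    and "(\<integral>\<omega>. X \<omega> \<partial>M) = K' 0"
    and "(\<integral>\<omega>. (X \<omega>)\<^sup>2 \<partial>M) = (K' 0)\<^sup>2 + v"
proof -
  interpret prob_space M by fact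
  have K0: "K 0 = 0"
    using has_bochner_integral_integral_eq[OF mgf[of 0]] d prob_space by simp
  let ?B = "\<lambda>\<omega>. 24 * (exp (d * X \<omega>) + exp (- d * X \<omega>)) / d ^ 4"
  have hB: "has_bochner_integral M ?B (24 * (exp (K d) + exp (K (- d))) / d ^ 4)"
    using d by (intro has_bochner_integral_divide has_bochner_integral_mult_right has_bochner_integral_add mgf) auto
  have XB: "(X \<omega>) ^ 4 \<le> ?B \<omega>" for \<omega>
    using fourth_power_le_exp[of "d * X \<omega>"] d by (simp add: field_simps)
  show I: "integrable M (\<lambda>\<omega>. (X \<omega>) ^ 4)"
  proof (rule Bochner_Integration.integrable_bound[of M ?B])
    show "integrable M ?B" using hB by (simp only: has_bochner_integral_iff)
    show "AE \<omega> in M. norm ((X \<omega>) ^ 4) \<le> norm (?B \<omega>)" using order_trans[OF XB abs_ge_self] by simp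
  qed measurable
  have "(\<integral>\<omega>. (X \<omega>) ^ 4 \<partial>M) \<le> (\<integral>\<omega>. ?B \<omega> \<partial>M)"
    using I hB XB by (intro integral_mono) (simp_all only: has_bochner_integral_iff)
  also have "\<dots> = 24 * (exp (K d) + exp (K (- d))) / d ^ 4" using hB by (simp only: has_bochner_integral_iff)
  also have "\<dots> \<le> 24 * (3 + 3) / d ^ 4"
  proof -
    have "exp (K d) \<le> 3" "exp (K (- d)) \<le> 3"
      using order_trans[OF _ exp_le] K1[of d] K1[of "- d"] d by auto
    then show ?thesis using d by (intro divide_right_mono) auto
  qed
  finally show "(\<integral>\<omega>. (X \<omega>) ^ 4 \<partial>M) \<le> 144 / d ^ 4" by simp
  have i0: "integrable M (\<lambda>\<omega>. 1 * exp (s * X \<omega>))" if "\<bar>s\<bar> < d" for s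
    using mgf[of s] that by (simp add: has_bochner_integral_iff)
  have i1: "integrable M (\<lambda>\<omega>. X \<omega> * exp (s * X \<omega>))" if "\<bar>s\<bar> < d" for s
    using has_derivative_weighted_exp_moment(1)[OF X borel_measurable_const i0 that] by simp
  have first: "(\<integral>\<omega>. X \<omega> * exp (s * X \<omega>) \<partial>M) = exp (K s) * K' s" if s: "\<bar>s\<bar> < d" for s
  proof (rule DERIV_unique)
    show "((\<lambda>s. \<integral>\<omega>. exp (s * X \<omega>) \<partial>M) has_real_derivative (\<integral>\<omega>. X \<omega> * exp (s * X \<omega>) \<partial>M)) (at s)"
      using has_derivative_weighted_exp_moment(2)[OF X borel_measurable_const i0 s] by simp
    have "((\<lambda>s. exp (K s)) has_real_derivative exp (K s) * K' s) (at s)"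
      using K'[of s] s by (auto intro!: derivative_eq_intros)
    then show "((\<lambda>s. \<integral>\<omega>. exp (s * X \<omega>) \<partial>M) has_real_derivative exp (K s) * K' s) (at s)"
    proof (rule has_field_derivative_transform_within_open[of _ _ _ "{-d<..<d}"])
      show "exp (K x) = (\<integral>\<omega>. exp (x * X \<omega>) \<partial>M)" if "x \<in> {-d<..<d}" for x
        using mgf[of x] that by (auto simp: has_bochner_integral_iff)
    qed (use s in auto)
  qed
  from first[of 0] d K0 show "(\<integral>\<omega>. X \<omega> \<partial>M) = K' 0" by simp
  show "(\<integral>\<omega>. (X \<omega>)\<^sup>2 \<partial>M) = (K' 0)\<^sup>2 + v"
  proof (rule DERIV_unique)
    show "((\<lambda>s. \<integral>\<omega>. X \<omega> * exp (s * X \<omega>) \<partial>M) has_real_derivative (\<integral>\<omega>. (X \<omega>)\<^sup>2 \<partial>M)) (at 0)"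
      using has_derivative_weighted_exp_moment(2)[OF X X i1, where s = 0] d by (simp add: power2_eq_square)
    have "((\<lambda>s. exp (K s) * K' s) has_real_derivative (K' 0)\<^sup>2 + v) (at 0)"
      using K'[of 0] K'' d K0 by (auto intro!: derivative_eq_intros simp: power2_eq_square)
    then show "((\<lambda>s. \<integral>\<omega>. X \<omega> * exp (s * X \<omega>) \<partial>M) has_real_derivative (K' 0)\<^sup>2 + v) (at 0)"
      by (rule has_field_derivative_transform_within_open[of _ _ _ "{-d<..<d}"])
        (use d first in auto)
  qed
qed

section \<open>Moment generating functions of the families\<close>

text \<open>The cumulant functions of the negative binomial, gamma and GHS families are of the form
  \<open>- r * ln (1 - y)\<close>; this is the size of \<open>y\<close> for which they stay at most \<open>1\<close>.\<close>
lemma neg_ln_one_minus_le_one: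
  fixes r y :: real
  assumes "0 \<le> r" "y \<le> 1 / (2 * (1 + r))"
  shows "0 < 1 - y" and "- r * ln (1 - y) \<le> 1"
proof -
  have "1 / (2 * (1 + r)) \<le> 1 / 2" using assms by (simp add: field_simps)
  with assms have y: "y \<le> 1 / 2" by linarith
  then show pos: "0 < 1 - y" by simp
  have ry: "2 * r * y \<le> 1"
  proof -
    have "2 * r * y \<le> 2 * r * (1 / (2 * (1 + r)))" using assms by (intro mult_left_mono) auto
    also have "\<dots> \<le> 1" using assms by (simp add: field_simps)
    finally show ?thesis .
  qed
  show "- r * ln (1 - y) \<le> 1"
  proof (cases "0 \<le> y")
    case True
    have "- ln (1 - y) = ln (1 / (1 - y))" using pos by (simp add: ln_div)
    also have "\<dots> \<le> 1 / (1 - y) - 1" using pos by (intro ln_le_minus_one) auto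
    also have "\<dots> \<le> 2 * y" using pos y True mult_right_mono[of y "1/2" y] by (simp add: field_simps)
    finally have "r * (- ln (1 - y)) \<le> r * (2 * y)" using assms by (intro mult_left_mono) auto
    with ry show ?thesis by simp
  next
    case False
    then have "0 \<le> ln (1 - y)" by (intro ln_ge_zero) auto
    then have "- r * ln (1 - y) \<le> 0" using assms by simp
    then show ?thesis by linarith
  qed
qed

lemma exp_minus_one_le_twice_abs:
  fixes s :: real
  assumes "\<bar>s\<bar> \<le> 1"
  shows "exp s - 1 \<le> 2 * \<bar>s\<bar>"
proof (cases "0 \<le> s")
  case True
  have "exp s \<le> 1 + s + s\<^sup>2" using True assms by (intro exp_bound) auto
  moreover have "s\<^sup>2 \<le> s" using True assms by (simp add: power2_eq_square mult_left_le)
  ultimately show ?thesis using True by simp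
next
  case False
  then have "exp s \<le> 1" by simp
  then show ?thesis by linarith
qed

text \<open>Exponential tilting: if multiplying the mass function of \<open>q\<close> by \<open>exp (s * k)\<close> gives a multiple
  of another mass function, the factor is the moment generating function at \<open>s\<close>, since
  probabilities sum to \<open>1\<close>. Each discrete family is closed under tilting, so that no power series
  has to be summed.\<close>
lemma mgf_of_nat_law_by_tilting:
  assumes law: "has_nat_law M X q" and c: "0 \<le> c"
    and tilt: "\<And>k. pmf q k * exp (s * real k) = c * pmf q' k"
  shows "has_bochner_integral M (\<lambda>\<omega>. exp (s * X \<omega>)) c"
proof (rule has_bochner_integral_nn_integral)
  have X[measurable]: "X \<in> borel_measurable M" using law by (simp add: has_nat_law_def)
  show "(\<lambda>\<omega>. exp (s * X \<omega>)) \<in> borel_measurable M" by measurable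
  have "(\<integral>\<^sup>+\<omega>. ennreal (exp (s * X \<omega>)) \<partial>M) = (\<integral>\<^sup>+x. ennreal (exp (s * x)) \<partial>distr M borel X)"
    by (subst nn_integral_distr) auto
  also have "\<dots> = (\<integral>\<^sup>+k. ennreal (exp (s * real k)) \<partial>measure_pmf q)"
    using law by (simp add: has_nat_law_def nn_integral_distr)
  also have "\<dots> = (\<integral>\<^sup>+k. ennreal (pmf q k * exp (s * real k)) \<partial>count_space UNIV)"
    by (simp add: nn_integral_measure_pmf ennreal_mult)
  also have "\<dots> = (\<integral>\<^sup>+k. ennreal c * ennreal (pmf q' k) \<partial>count_space UNIV)"
    using c by (simp add: tilt ennreal_mult)
  also have "\<dots> = ennreal c"
    by (simp add: nn_integral_cmult nn_integral_pmf)
  finally show "(\<integral>\<^sup>+\<omega>. ennreal (exp (s * X \<omega>)) \<partial>M) = ennreal c" .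
qed (use c in auto)

lemma mgf_binomial:
  assumes law: "has_nat_law M X (binomial_pmf n p)" and p: "0 < p" "p < 1"
  shows "has_bochner_integral M (\<lambda>\<omega>. exp (s * X \<omega>)) (exp (real n * ln (1 + p * (exp s - 1))))"
proof (rule mgf_of_nat_law_by_tilting[OF law, of _ _ "binomial_pmf n (p * exp s / (1 + p * (exp s - 1)))"])
  fix k
  define a where "a = 1 + p * (exp s - 1)"
  have a: "a = (1 - p) + p * exp s" by (simp add: a_def algebra_simps)
  have apos: "0 < a" unfolding a using p by (intro add_pos_pos) auto
  have 1: "1 - p * exp s / a = (1 - p) / a" using apos by (simp add: a field_simps)
  have r: "0 \<le> p * exp s / a" "p * exp s / a \<le> 1" using apos p by (simp_all add: a)
  have "pmf (binomial_pmf n p) k * exp (s * real k) = a ^ n * pmf (binomial_pmf n (p * exp s / a)) k"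
  proof (cases "k \<le> n")
    case True
    then have "a ^ n = a ^ k * a ^ (n - k)" by (simp flip: power_add)
    then show ?thesis
      using apos p r by (simp add: pmf_binomial 1 power_divide power_mult_distrib exp_of_nat2_mult)
  next
    case False
    then show ?thesis using p r by (simp add: pmf_binomial binomial_eq_0)
  qed
  also have "a ^ n = exp (real n * ln a)" using apos by (simp add: exp_of_nat_mult)
  finally show "pmf (binomial_pmf n p) k * exp (s * real k) =
      exp (real n * ln (1 + p * (exp s - 1))) * pmf (binomial_pmf n (p * exp s / (1 + p * (exp s - 1)))) k"
    unfolding a_def .
qed auto

lemma mgf_poisson:
  assumes law: "has_nat_law M X (poisson_pmf \<mu>)" and \<mu>: "0 < \<mu>"
  shows "has_bochner_integral M (\<lambda>\<omega>. exp (s * X \<omega>)) (exp (\<mu> * (exp s - 1)))"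
proof (rule mgf_of_nat_law_by_tilting[OF law, of _ _ "poisson_pmf (\<mu> * exp s)"])
  fix k
  show "pmf (poisson_pmf \<mu>) k * exp (s * real k) = exp (\<mu> * (exp s - 1)) * pmf (poisson_pmf (\<mu> * exp s)) k"
    using \<mu> by (simp add: power_mult_distrib exp_of_nat2_mult right_diff_distrib exp_diff exp_minus field_simps)
qed auto

lemma mgf_neg_binomial:
  assumes law: "has_nat_law M X (neg_binomial_pmf n (1 - p))" and p: "0 < p" "p < 1"
    and s: "0 < 1 - p / (1 - p) * (exp s - 1)"
  shows "has_bochner_integral M (\<lambda>\<omega>. exp (s * X \<omega>)) (exp (- real n * ln (1 - p / (1 - p) * (exp s - 1))))"
proof (rule mgf_of_nat_law_by_tilting[OF law, of _ _ "neg_binomial_pmf n (1 - p * exp s)"])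
  fix k
  define b where "b = 1 - p / (1 - p) * (exp s - 1)"
  have b: "b = (1 - p * exp s) / (1 - p)" using p by (simp add: b_def field_simps)
  have bpos: "0 < b" using s by (simp add: b_def)
  then have q: "0 < 1 - p * exp s" using p by (simp add: b zero_less_divide_iff)
  have "pmf (neg_binomial_pmf n (1 - p)) k * exp (s * real k)
      = ((1 - p) / (1 - p * exp s)) ^ n * pmf (neg_binomial_pmf n (1 - p * exp s)) k"
    using p q by (simp add: pmf_neg_binomial power_divide power_mult_distrib exp_of_nat2_mult)
  also have "((1 - p) / (1 - p * exp s)) ^ n = exp (- real n * ln b)"
    using bpos p q by (simp add: exp_minus exp_of_nat_mult b power_divide)
  finally show "pmf (neg_binomial_pmf n (1 - p)) k * exp (s * real k) =
      exp (- real n * ln (1 - p / (1 - p) * (exp s - 1))) * pmf (neg_binomial_pmf n (1 - p * exp s)) k"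
    unfolding b_def .
qed auto

text \<open>Tilting again: \<open>gamma_pdf k l x * exp (s * x)\<close> is a multiple of the density with scale
  \<open>l / (1 - l * s)\<close>, and rescaling the axis turns that density into \<open>gamma_pdf k l\<close>, whose integral is
  \<open>1\<close> because it is the density of \<open>X\<close>.\<close>
lemma mgf_gamma:
  assumes M: "prob_space M"
    and law: "distributed M lborel X (\<lambda>x. ennreal (gamma_pdf k l x))" and l: "0 < l" and k: "0 < k"
    and s: "0 < 1 - l * s"
  shows "has_bochner_integral M (\<lambda>\<omega>. exp (s * X \<omega>)) (exp (- k * ln (1 - l * s)))"
proof (rule has_bochner_integral_nn_integral)
  interpret prob_space M by fact
  have X[measurable]: "X \<in> borel_measurable M" using distributed_measurable[OF law] by simp
  show "(\<lambda>\<omega>. exp (s * X \<omega>)) \<in> borel_measurable M" by measurable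
  define b where "b = 1 - l * s"
  have b: "0 < b" using s by (simp add: b_def)
  have nonneg: "0 \<le> gamma_pdf k l x" for x using k l by (simp add: gamma_pdf_def Gamma_real_pos)
  have [measurable]: "gamma_pdf k l \<in> borel_measurable borel" unfolding gamma_pdf_def[abs_def] by measurable
  have tilt: "gamma_pdf k l x * exp (s * x) = b powr (- k) * (b * gamma_pdf k l (b * x))" for x
  proof (cases "x > 0")
    case True
    have "b * (b * x) powr (k - 1) = b powr k * x powr (k - 1)"
      using b True by (simp add: powr_mult powr_diff)
    then have "b powr (- k) * (b * (b * x) powr (k - 1)) = x powr (k - 1)"
      using b by (simp add: powr_minus)
    moreover have "exp (- x / l) * exp (s * x) = exp (- (b * x) / l)"
      using l by (simp add: b_def mult_exp_exp field_simps)
    ultimately show ?thesis using b True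
      by (simp add: gamma_pdf_def) (metis (no_types, lifting) mult.assoc mult.commute)
  qed (use b in \<open>simp add: gamma_pdf_def zero_less_mult_iff\<close>)
  have "(\<integral>\<^sup>+x. ennreal (gamma_pdf k l x) \<partial>lborel) = emeasure M (space M)"
    using distributed_emeasure[OF law, of UNIV] by simp
  then have one: "(\<integral>\<^sup>+x. ennreal (gamma_pdf k l x) \<partial>lborel) = 1" by (simp add: emeasure_space_1)
  have "(\<integral>\<^sup>+x. ennreal (gamma_pdf k l x) \<partial>lborel) = ennreal b * (\<integral>\<^sup>+x. ennreal (gamma_pdf k l (b * x)) \<partial>lborel)"
    using nn_integral_real_affine[of "\<lambda>x. ennreal (gamma_pdf k l x)" b 0] b by simp
  with one have scaled: "ennreal b * (\<integral>\<^sup>+x. ennreal (gamma_pdf k l (b * x)) \<partial>lborel) = 1" by simp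
  have "(\<integral>\<^sup>+\<omega>. ennreal (exp (s * X \<omega>)) \<partial>M) = (\<integral>\<^sup>+x. ennreal (gamma_pdf k l x) * ennreal (exp (s * x)) \<partial>lborel)"
    by (subst distributed_nn_integral[OF law]) auto
  also have "\<dots> = (\<integral>\<^sup>+x. ennreal (b powr (- k)) * (ennreal b * ennreal (gamma_pdf k l (b * x))) \<partial>lborel)"
    using b nonneg by (simp add: tilt flip: ennreal_mult)
  also have "\<dots> = ennreal (b powr (- k))"
    by (simp add: nn_integral_cmult scaled)
  also have "b powr (- k) = exp (- k * ln (1 - l * s))" using b by (simp add: powr_def b_def)
  finally show "(\<integral>\<^sup>+\<omega>. ennreal (exp (s * X \<omega>)) \<partial>M) = ennreal (exp (- k * ln (1 - l * s)))" .
qed auto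

section \<open>Moments of the observations\<close>

text \<open>What the risk comparison needs to know about one observation with mean \<open>m\<close> and variance \<open>v\<close>;
  the number \<open>B\<close> bounds the fourth moment on the scale of the observation itself.\<close>
definition moments_up_to_four :: "'a measure \<Rightarrow> ('a \<Rightarrow> real) \<Rightarrow> real \<Rightarrow> real \<Rightarrow> real \<Rightarrow> bool" where
  "moments_up_to_four M Y m v B \<longleftrightarrow>
     Y \<in> borel_measurable M \<and> integrable M (\<lambda>\<omega>. (Y \<omega>) ^ 4) \<and>
     (\<integral>\<omega>. Y \<omega> \<partial>M) = m \<and> (\<integral>\<omega>. (Y \<omega>)\<^sup>2 \<partial>M) = m\<^sup>2 + v \<and> (\<integral>\<omega>. (Y \<omega>) ^ 4 \<partial>M) \<le> 144 * B ^ 4"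

text \<open>The families describe \<open>\<tau> * Y\<close>. A radius \<open>d\<close> of order \<open>1 / (\<tau> (1 + \<bar>m\<bar>))\<close> for the cumulant
  function of \<open>\<tau> * Y\<close> therefore yields a fourth moment of order \<open>(1 + \<bar>m\<bar>)\<^sup>4\<close> for \<open>Y\<close>,
  uniformly in \<open>\<tau>\<close>; each of the next five lemmas exhibits such a radius.\<close>
lemma moments_up_to_four_scaled:
  fixes Y :: "'a \<Rightarrow> real"
  assumes M: "prob_space M" and X: "(\<lambda>\<omega>. \<tau> * Y \<omega>) \<in> borel_measurable M" and \<tau>: "0 < \<tau>" and d: "0 < d"
    and mgf: "\<And>s. \<bar>s\<bar> \<le> d \<Longrightarrow> has_bochner_integral M (\<lambda>\<omega>. exp (s * (\<tau> * Y \<omega>))) (exp (K s))"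
    and K1: "\<And>s. \<bar>s\<bar> \<le> d \<Longrightarrow> K s \<le> 1"
    and K': "\<And>s. \<bar>s\<bar> \<le> d \<Longrightarrow> (K has_real_derivative K' s) (at s)"
    and m: "K' 0 = \<tau> * m" and v: "(K' has_real_derivative \<tau> * v) (at 0)"
    and B: "1 / (d * \<tau>) \<le> B"
  shows "moments_up_to_four M Y m (v / \<tau>) B"
proof -
  note mom = moments_from_cumulant_function[OF M X d mgf K1 K' v]
  have Y: "Y \<in> borel_measurable M"
  proof -
    have "(\<lambda>\<omega>. (\<tau> * Y \<omega>) / \<tau>) \<in> borel_measurable M" using X by (rule borel_measurable_divide) simp
    then show ?thesis using \<tau> by simp
  qed
  have int: "integrable M (\<lambda>\<omega>. (Y \<omega>) ^ 4)" and b4: "\<tau> ^ 4 * (\<integral>\<omega>. (Y \<omega>) ^ 4 \<partial>M) \<le> 144 / d ^ 4"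
    using mom(1,2) \<tau> by (simp_all add: power_mult_distrib)
  have "(\<integral>\<omega>. Y \<omega> \<partial>M) = m" using mom(3) m \<tau> by simp
  moreover have "(\<integral>\<omega>. (Y \<omega>)\<^sup>2 \<partial>M) = m\<^sup>2 + v / \<tau>"
  proof -
    have "\<tau>\<^sup>2 * (\<integral>\<omega>. (Y \<omega>)\<^sup>2 \<partial>M) = \<tau>\<^sup>2 * (m\<^sup>2 + v / \<tau>)"
      using mom(4) m \<tau> by (simp add: power_mult_distrib power2_eq_square field_simps)
    then show ?thesis using \<tau> by simp
  qed
  moreover have "(\<integral>\<omega>. (Y \<omega>) ^ 4 \<partial>M) \<le> 144 * (1 / (d * \<tau>)) ^ 4"
    using b4 \<tau> d by (simp add: power_mult_distrib power_divide field_simps)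
  moreover have "144 * (1 / (d * \<tau>)) ^ 4 \<le> 144 * B ^ 4"
    using B \<tau> d by (intro mult_left_mono power_mono) auto
  ultimately show ?thesis using Y int by (auto simp: moments_up_to_four_def)
qed

lemma binomial_moments:
  assumes M: "prob_space M" and obs: "nef_obs BinomialFam M \<tau> p Y"
  shows "moments_up_to_four M Y p (var_fun BinomialFam p / \<tau>) (2 * (1 + \<bar>p\<bar>))"
proof -
  from obs obtain n :: nat where p: "0 < p" "p < 1" and n: "1 \<le> n" "\<tau> = real n"
    and law: "has_nat_law M (\<lambda>\<omega>. \<tau> * Y \<omega>) (binomial_pmf n p)" by auto
  have pos: "0 < 1 + p * (exp s - 1)" for s :: real
  proof -
    have "0 < (1 - p) + p * exp s" using p by (intro add_pos_pos) auto
    then show ?thesis by (simp add: algebra_simps)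
  qed
  show ?thesis
  proof (rule moments_up_to_four_scaled[OF M, where d = "1 / (1 + 2 * real n * p)"
        and K = "\<lambda>s. real n * ln (1 + p * (exp s - 1))"
        and K' = "\<lambda>s. real n * (p * exp s / (1 + p * (exp s - 1)))"])
    show "(\<lambda>\<omega>. \<tau> * Y \<omega>) \<in> borel_measurable M" using law by (simp add: has_nat_law_def)
    show "0 < \<tau>" using n by simp
    show "0 < 1 / (1 + 2 * real n * p)" using p by (simp add: add_pos_nonneg)
    show "has_bochner_integral M (\<lambda>\<omega>. exp (s * (\<tau> * Y \<omega>))) (exp (real n * ln (1 + p * (exp s - 1))))" for s
      by (rule mgf_binomial[OF law p])
    show "real n * ln (1 + p * (exp s - 1)) \<le> 1" if s: "\<bar>s\<bar> \<le> 1 / (1 + 2 * real n * p)" for s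
    proof -
      have s1: "\<bar>s\<bar> \<le> 1" using p by (rule_tac order_trans[OF s]) (simp add: divide_le_eq_1 add_pos_nonneg)
      have "ln (1 + p * (exp s - 1)) \<le> p * (exp s - 1)"
        using ln_le_minus_one[OF pos[of s]] by simp
      also have "\<dots> \<le> p * (2 * \<bar>s\<bar>)" using exp_minus_one_le_twice_abs[OF s1] p by simp
      finally have "real n * ln (1 + p * (exp s - 1)) \<le> real n * (p * (2 * \<bar>s\<bar>))"
        by (intro mult_left_mono) auto
      also have "\<dots> = (2 * real n * p) * \<bar>s\<bar>" by simp
      also have "\<dots> \<le> (2 * real n * p) * (1 / (1 + 2 * real n * p))" using s p by (intro mult_left_mono) auto
      also have "\<dots> \<le> 1" using p by (simp add: field_simps add_pos_nonneg)
      finally show ?thesis .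
    qed
    show "((\<lambda>s. real n * ln (1 + p * (exp s - 1))) has_real_derivative
        real n * (p * exp s / (1 + p * (exp s - 1)))) (at s)" for s
      using pos[of s] by (auto intro!: derivative_eq_intros)
    show "real n * (p * exp 0 / (1 + p * (exp 0 - 1))) = \<tau> * p" using n by simp
    show "((\<lambda>s. real n * (p * exp s / (1 + p * (exp s - 1)))) has_real_derivative \<tau> * var_fun BinomialFam p) (at 0)"
      using n by (auto intro!: derivative_eq_intros simp: var_fun_def power2_eq_square algebra_simps)
    have "1 / real n \<le> 2" using n by (simp add: field_simps)
    then show "1 / (1 / (1 + 2 * real n * p) * \<tau>) \<le> 2 * (1 + \<bar>p\<bar>)"
      using n p by (simp add: add_divide_distrib)
  qed
qed

lemma poisson_moments:
  assumes M: "prob_space M" and obs: "nef_obs PoissonFam M \<tau> t Y" and c: "0 < c" "c \<le> \<tau>"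
  shows "moments_up_to_four M Y t (var_fun PoissonFam t / \<tau>) ((1 / c + 2) * (1 + \<bar>t\<bar>))"
proof -
  from obs have \<tau>: "0 < \<tau>" and t: "0 < t" and law: "has_nat_law M (\<lambda>\<omega>. \<tau> * Y \<omega>) (poisson_pmf (\<tau> * t))" by auto
  then have \<mu>: "0 < \<tau> * t" by simp
  show ?thesis
  proof (rule moments_up_to_four_scaled[OF M, where d = "1 / (1 + 2 * (\<tau> * t))"
        and K = "\<lambda>s. \<tau> * t * (exp s - 1)" and K' = "\<lambda>s. \<tau> * t * exp s"])
    show "(\<lambda>\<omega>. \<tau> * Y \<omega>) \<in> borel_measurable M" using law by (simp add: has_nat_law_def)
    show "0 < \<tau>" by fact
    show "0 < 1 / (1 + 2 * (\<tau> * t))" using \<mu> by simp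
    show "has_bochner_integral M (\<lambda>\<omega>. exp (s * (\<tau> * Y \<omega>))) (exp (\<tau> * t * (exp s - 1)))" for s
      by (rule mgf_poisson[OF law \<mu>])
    show "\<tau> * t * (exp s - 1) \<le> 1" if s: "\<bar>s\<bar> \<le> 1 / (1 + 2 * (\<tau> * t))" for s
    proof -
      have s1: "\<bar>s\<bar> \<le> 1" using \<mu> by (rule_tac order_trans[OF s]) (auto simp: field_simps)
      have "\<tau> * t * (exp s - 1) \<le> \<tau> * t * (2 * \<bar>s\<bar>)"
        using exp_minus_one_le_twice_abs[OF s1] \<mu> by (intro mult_left_mono) auto
      also have "\<dots> = 2 * (\<tau> * t) * \<bar>s\<bar>" by simp
      also have "\<dots> \<le> 2 * (\<tau> * t) * (1 / (1 + 2 * (\<tau> * t)))" using s \<mu> by (intro mult_left_mono) auto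
      also have "\<dots> \<le> 1" using \<mu> by (simp add: field_simps)
      finally show ?thesis .
    qed
    show "((\<lambda>s. \<tau> * t * (exp s - 1)) has_real_derivative \<tau> * t * exp s) (at s)" for s
      by (auto intro!: derivative_eq_intros)
    show "\<tau> * t * exp 0 = \<tau> * t" by simp
    show "((\<lambda>s. \<tau> * t * exp s) has_real_derivative \<tau> * var_fun PoissonFam t) (at 0)"
      by (auto intro!: derivative_eq_intros simp: var_fun_def)
    have "1 / (1 / (1 + 2 * (\<tau> * t)) * \<tau>) = 1 / \<tau> + 2 * t" using \<tau> by (simp add: field_simps)
    also have "1 / \<tau> \<le> 1 / c" using c by (simp add: frac_le)
    also have "1 / c + 2 * t \<le> (1 / c + 2) * (1 + \<bar>t\<bar>)" using t c by (simp add: distrib_left distrib_right)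
    finally show "1 / (1 / (1 + 2 * (\<tau> * t)) * \<tau>) \<le> (1 / c + 2) * (1 + \<bar>t\<bar>)" by simp
  qed
qed

lemma neg_binomial_moments:
  assumes M: "prob_space M" and obs: "nef_obs NegBinomialFam M \<tau> p Y"
  shows "moments_up_to_four M Y (p / (1 - p)) (var_fun NegBinomialFam (p / (1 - p)) / \<tau>)
    (8 * (1 + \<bar>p / (1 - p)\<bar>))"
proof -
  from obs obtain n :: nat where p: "0 < p" "p < 1" and n: "1 \<le> n" "\<tau> = real n"
    and law: "has_nat_law M (\<lambda>\<omega>. \<tau> * Y \<omega>) (neg_binomial_pmf n (1 - p))" by auto
  define t where "t = p / (1 - p)"
  have t: "0 < t" using p by (simp add: t_def)
  define d where "d = 1 / (4 * ((1 + real n) * (1 + t)))"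
  have d: "0 < d" using t by (simp add: d_def)
  have y: "t * (exp s - 1) \<le> 1 / (2 * (1 + real n))" if s: "\<bar>s\<bar> \<le> d" for s
  proof -
    have "1 \<le> (1 + real n) * (1 + t)" using t mult_mono[of 1 "1 + real n" 1 "1 + t"] by simp
    then have "d \<le> 1" by (simp add: d_def)
    with s have "\<bar>s\<bar> \<le> 1" by simp
    from exp_minus_one_le_twice_abs[OF this] have "t * (exp s - 1) \<le> t * (2 * \<bar>s\<bar>)"
      using t by (intro mult_left_mono) auto
    also have "\<dots> \<le> (1 + t) * (2 * d)" using s t by (intro mult_mono) auto
    also have "\<dots> = 1 / (2 * (1 + real n))" using t by (simp add: d_def)
    finally show ?thesis .
  qed
  note ln1 = neg_ln_one_minus_le_one[OF of_nat_0_le_iff y]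
  have "moments_up_to_four M Y t (var_fun NegBinomialFam t / \<tau>) (8 * (1 + \<bar>t\<bar>))"
  proof (rule moments_up_to_four_scaled[OF M, where d = d
        and K = "\<lambda>s. - real n * ln (1 - t * (exp s - 1))"
        and K' = "\<lambda>s. real n * (t * exp s / (1 - t * (exp s - 1)))"])
    show "(\<lambda>\<omega>. \<tau> * Y \<omega>) \<in> borel_measurable M" using law by (simp add: has_nat_law_def)
    show "0 < \<tau>" using n by simp
    show "0 < d" by fact
    show "has_bochner_integral M (\<lambda>\<omega>. exp (s * (\<tau> * Y \<omega>))) (exp (- real n * ln (1 - t * (exp s - 1))))"
      if "\<bar>s\<bar> \<le> d" for s
      using mgf_neg_binomial[OF law p] ln1(1)[OF that] unfolding t_def by simp
    show "- real n * ln (1 - t * (exp s - 1)) \<le> 1" if "\<bar>s\<bar> \<le> d" for s by (rule ln1(2)[OF that])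
    show "((\<lambda>s. - real n * ln (1 - t * (exp s - 1))) has_real_derivative
        real n * (t * exp s / (1 - t * (exp s - 1)))) (at s)" if "\<bar>s\<bar> \<le> d" for s
      using ln1(1)[OF that] by (auto intro!: derivative_eq_intros)
    show "real n * (t * exp 0 / (1 - t * (exp 0 - 1))) = \<tau> * t" using n by simp
    show "((\<lambda>s. real n * (t * exp s / (1 - t * (exp s - 1)))) has_real_derivative \<tau> * var_fun NegBinomialFam t) (at 0)"
      using n by (auto intro!: derivative_eq_intros simp: var_fun_def power2_eq_square algebra_simps)
    have "1 / (d * \<tau>) = 4 * (1 + t) * ((1 + real n) / real n)" using n t by (simp add: d_def field_simps)
    also have "\<dots> \<le> 4 * (1 + t) * 2" using n t by (intro mult_left_mono) (auto simp: field_simps)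
    finally show "1 / (d * \<tau>) \<le> 8 * (1 + \<bar>t\<bar>)" using t by simp
  qed
  then show ?thesis by (simp add: t_def)
qed

lemma gamma_moments:
  assumes M: "prob_space M" and obs: "nef_obs (GammaFam \<alpha>) M \<tau> l Y" and c: "0 < c" "c \<le> \<tau>"
  shows "moments_up_to_four M Y (\<alpha> * l) (var_fun (GammaFam \<alpha>) (\<alpha> * l) / \<tau>)
    (2 * (1 / c + \<alpha>) * (1 + 1 / \<alpha>) * (1 + \<bar>\<alpha> * l\<bar>))"
proof -
  from obs have \<alpha>: "0 < \<alpha>" and \<tau>: "0 < \<tau>" and l: "0 < l"
    and law: "distributed M lborel (\<lambda>\<omega>. \<tau> * Y \<omega>) (\<lambda>x. ennreal (gamma_pdf (\<tau> * \<alpha>) l x))" by auto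
  define k where "k = \<tau> * \<alpha>"
  have k: "0 < k" using \<alpha> \<tau> by (simp add: k_def)
  define d where "d = 1 / (2 * ((1 + k) * (1 + l)))"
  have d: "0 < d" using k l by (simp add: d_def)
  have y: "l * s \<le> 1 / (2 * (1 + k))" if s: "\<bar>s\<bar> \<le> d" for s
  proof -
    have "l * s \<le> (1 + l) * d"
      using s l d by (intro order_trans[OF mult_left_mono mult_right_mono[of l "1 + l" d]]) auto
    also have "\<dots> = 1 / (2 * (1 + k))" using l by (simp add: d_def)
    finally show ?thesis .
  qed
  note ln1 = neg_ln_one_minus_le_one[OF less_imp_le[OF k] y]
  show ?thesis
  proof (rule moments_up_to_four_scaled[OF M, where d = d
        and K = "\<lambda>s. - k * ln (1 - l * s)" and K' = "\<lambda>s. k * (l / (1 - l * s))"])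
    show "(\<lambda>\<omega>. \<tau> * Y \<omega>) \<in> borel_measurable M" using distributed_measurable[OF law] by simp
    show "0 < \<tau>" "0 < d" by fact+
    show "has_bochner_integral M (\<lambda>\<omega>. exp (s * (\<tau> * Y \<omega>))) (exp (- k * ln (1 - l * s)))" if "\<bar>s\<bar> \<le> d" for s
      using mgf_gamma[OF M law l] ln1(1)[OF that] k by (simp add: k_def)
    show "- k * ln (1 - l * s) \<le> 1" if "\<bar>s\<bar> \<le> d" for s by (rule ln1(2)[OF that])
    show "((\<lambda>s. - k * ln (1 - l * s)) has_real_derivative k * (l / (1 - l * s))) (at s)" if "\<bar>s\<bar> \<le> d" for s
      using ln1(1)[OF that] by (auto intro!: derivative_eq_intros)
    show "k * (l / (1 - l * 0)) = \<tau> * (\<alpha> * l)" by (simp add: k_def)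
    show "((\<lambda>s. k * (l / (1 - l * s))) has_real_derivative \<tau> * var_fun (GammaFam \<alpha>) (\<alpha> * l)) (at 0)"
      using \<alpha> by (auto intro!: derivative_eq_intros simp: var_fun_def power2_eq_square k_def)
    have "1 / (d * \<tau>) = 2 * (1 / \<tau> + \<alpha>) * (1 + l)" using \<tau> k l by (simp add: d_def k_def field_simps)
    also have "\<dots> \<le> 2 * (1 / c + \<alpha>) * (1 + l)"
      using c l by (intro mult_right_mono) (auto simp: frac_le)
    also have "\<dots> \<le> 2 * (1 / c + \<alpha>) * ((1 + 1 / \<alpha>) * (1 + \<bar>\<alpha> * l\<bar>))"
      using c l \<alpha> by (intro mult_left_mono) (auto simp: algebra_simps)
    finally show "1 / (d * \<tau>) \<le> 2 * (1 / c + \<alpha>) * (1 + 1 / \<alpha>) * (1 + \<bar>\<alpha> * l\<bar>)" by (simp only: mult.assoc)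
  qed
qed

lemma cos_pos_imp_abs_less_pi_half:
  fixes x :: real
  assumes "0 < cos x" "\<bar>x\<bar> \<le> pi"
  shows "\<bar>x\<bar> < pi / 2"
proof (rule ccontr)
  assume "\<not> \<bar>x\<bar> < pi / 2"
  then have "cos \<bar>x\<bar> \<le> cos (pi / 2)" using assms(2) by (intro cos_monotone_0_pi_le) auto
  with assms(1) show False by simp
qed

text \<open>With \<open>\<eta> = arctan l\<close> one has \<open>cos (\<eta> + s) / cos \<eta> = cos s - l * sin s\<close>, which is at least
  \<open>1 - (1 + \<bar>l\<bar>) \<bar>s\<bar>\<close> for small \<open>s\<close>. Positivity of this ratio also keeps \<open>\<eta> + s\<close> inside
  \<open>(- pi / 2, pi / 2)\<close>, where the moment generating function is prescribed.\<close>
lemma GHS_moments: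
  assumes M: "prob_space M" and obs: "nef_obs (GHSFam \<alpha>) M \<tau> l Y" and c: "0 < c" "c \<le> \<tau>"
  shows "moments_up_to_four M Y (\<alpha> * l) (var_fun (GHSFam \<alpha>) (\<alpha> * l) / \<tau>)
    (2 * (1 / c + \<alpha>) * (1 + 1 / \<alpha>) * (1 + \<bar>\<alpha> * l\<bar>))"
proof -
  from obs have \<alpha>: "0 < \<alpha>" and \<tau>: "0 < \<tau>" and law: "has_GHS_law M (\<lambda>\<omega>. \<tau> * Y \<omega>) (\<tau> * \<alpha>) l" by auto
  define r where "r = \<tau> * \<alpha>"
  have r: "0 < r" using \<alpha> \<tau> by (simp add: r_def)
  define \<eta> where "\<eta> = arctan l"
  have c\<eta>: "0 < cos \<eta>" by (simp add: \<eta>_def cos_arctan add_pos_nonneg)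
  have tan_eta: "tan \<eta> = l" by (simp add: \<eta>_def tan_arctan)
  have sin_eta: "sin \<eta> = l * cos \<eta>" using c\<eta> tan_eta by (simp add: tan_def field_simps)
  define d where "d = 1 / (2 * ((1 + r) * (1 + \<bar>l\<bar>)))"
  have d: "0 < d" using r by (simp add: d_def add_pos_nonneg)
  have dhalf: "d \<le> 1 / 2"
  proof -
    have "1 \<le> (1 + r) * (1 + \<bar>l\<bar>)" using r mult_mono[of 1 "1 + r" 1 "1 + \<bar>l\<bar>"] by simp
    then show ?thesis by (simp add: d_def field_simps)
  qed
  have y: "1 - (cos s - l * sin s) \<le> 1 / (2 * (1 + r))" if s: "\<bar>s\<bar> \<le> d" for s
  proof -
    have "1 - cos s \<le> s\<^sup>2 / 2"
    proof -
      have "cos s = 1 - 2 * (sin (s / 2))\<^sup>2" using cos_double_sin[of "s / 2"] by simp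
      moreover have "(sin (s / 2))\<^sup>2 \<le> (s / 2)\<^sup>2"
        by (rule abs_le_square_iff[THEN iffD1, OF abs_sin_x_le_abs_x])
      ultimately show ?thesis by (simp add: power2_eq_square)
    qed
    also have "s\<^sup>2 / 2 \<le> \<bar>s\<bar>"
      using s dhalf mult_right_mono[of "\<bar>s\<bar>" 1 "\<bar>s\<bar>"] by (simp add: power2_eq_square flip: abs_mult)
    finally have "1 - cos s \<le> \<bar>s\<bar>" .
    moreover have "l * sin s \<le> \<bar>l\<bar> * \<bar>s\<bar>"
      using abs_ge_self[of "l * sin s"] mult_left_mono[OF abs_sin_x_le_abs_x[of s], of "\<bar>l\<bar>"] by (simp add: abs_mult)
    ultimately have "1 - (cos s - l * sin s) \<le> (1 + \<bar>l\<bar>) * \<bar>s\<bar>" by (simp add: algebra_simps)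
    also have "\<dots> \<le> (1 + \<bar>l\<bar>) * d" using s by (intro mult_left_mono) auto
    also have "\<dots> = 1 / (2 * (1 + r))" by (simp add: d_def)
    finally show ?thesis .
  qed
  note ln1 = neg_ln_one_minus_le_one[OF less_imp_le[OF r] y]
  have cos_shift: "cos (\<eta> + s) = cos \<eta> * (cos s - l * sin s)" for s
    by (simp add: cos_add sin_eta algebra_simps)
  have cpos: "0 < cos (\<eta> + s)" if "\<bar>s\<bar> \<le> d" for s
    using ln1(1)[OF that] c\<eta> by (simp add: cos_shift)
  have dom: "\<bar>\<eta> + s\<bar> < pi / 2" if "\<bar>s\<bar> \<le> d" for s
  proof (rule cos_pos_imp_abs_less_pi_half[OF cpos[OF that]])
    have "\<bar>\<eta>\<bar> < pi / 2" using arctan_bounded[of l] by (auto simp: \<eta>_def)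
    then show "\<bar>\<eta> + s\<bar> \<le> pi" using that dhalf pi_gt3 by linarith
  qed
  have K: "r * ln (cos \<eta> / cos (\<eta> + s)) = - r * ln (1 - (1 - (cos s - l * sin s)))" if "\<bar>s\<bar> \<le> d" for s
    using c\<eta> ln1(1)[OF that] by (simp add: cos_shift ln_div)
  show ?thesis
  proof (rule moments_up_to_four_scaled[OF M, where d = d
        and K = "\<lambda>s. r * ln (cos \<eta> / cos (\<eta> + s))" and K' = "\<lambda>s. r * tan (\<eta> + s)"])
    show "(\<lambda>\<omega>. \<tau> * Y \<omega>) \<in> borel_measurable M" using law by (simp add: has_GHS_law_def)
    show "0 < \<tau>" "0 < d" by fact+
    show "has_bochner_integral M (\<lambda>\<omega>. exp (s * (\<tau> * Y \<omega>))) (exp (r * ln (cos \<eta> / cos (\<eta> + s))))" if "\<bar>s\<bar> \<le> d" for s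
    proof -
      have "has_bochner_integral M (\<lambda>\<omega>. exp (s * (\<tau> * Y \<omega>))) ((cos \<eta> / cos (\<eta> + s)) powr r)"
        using law dom[OF that] unfolding has_GHS_law_def r_def \<eta>_def by blast
      then show ?thesis using cpos[OF that] c\<eta> by (simp add: powr_def)
    qed
    show "r * ln (cos \<eta> / cos (\<eta> + s)) \<le> 1" if "\<bar>s\<bar> \<le> d" for s
      unfolding K[OF that] by (rule ln1(2)[OF that])
    show "((\<lambda>s. r * ln (cos \<eta> / cos (\<eta> + s))) has_real_derivative r * tan (\<eta> + s)) (at s)" if "\<bar>s\<bar> \<le> d" for s
      using cpos[OF that] c\<eta> by (auto intro!: derivative_eq_intros simp: tan_def field_simps)
    show "r * tan (\<eta> + 0) = \<tau> * (\<alpha> * l)" by (simp add: r_def tan_eta)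
    have "inverse ((cos \<eta>)\<^sup>2) = 1 + l\<^sup>2"
      using tan_sec[of \<eta>] c\<eta> by (simp add: tan_eta power_inverse)
    then show "((\<lambda>s. r * tan (\<eta> + s)) has_real_derivative \<tau> * var_fun (GHSFam \<alpha>) (\<alpha> * l)) (at 0)"
      using \<alpha> c\<eta> by (auto intro!: derivative_eq_intros simp: var_fun_def power2_eq_square r_def algebra_simps)
    have "1 / (d * \<tau>) = 2 * (1 / \<tau> + \<alpha>) * (1 + \<bar>l\<bar>)" using \<tau> r by (simp add: d_def r_def field_simps)
    also have "\<dots> \<le> 2 * (1 / c + \<alpha>) * (1 + \<bar>l\<bar>)"
      using c by (intro mult_right_mono) (auto simp: frac_le)
    also have "\<dots> \<le> 2 * (1 / c + \<alpha>) * ((1 + 1 / \<alpha>) * (1 + \<bar>\<alpha> * l\<bar>))"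
      using c \<alpha> by (intro mult_left_mono) (auto simp: algebra_simps abs_mult)
    finally show "1 / (d * \<tau>) \<le> 2 * (1 / c + \<alpha>) * (1 + 1 / \<alpha>) * (1 + \<bar>\<alpha> * l\<bar>)" by (simp only: mult.assoc)
  qed
qed

section \<open>Uniform approximation of the loss by the risk estimate\<close>

lemma obs_weight_eq:
  assumes "0 < t" shows "obs_weight t g = 1 - mean_weight t g"
proof -
  have "0 < t + enn2real g" using assms by (intro add_pos_nonneg) auto
  then show ?thesis by (simp add: obs_weight_def mean_weight_def eq_diff_eq flip: add_divide_distrib)
qed

lemma mean_weight_range:
  assumes "0 < t" shows "0 \<le> mean_weight t g" "mean_weight t g \<le> 1"
  using assms by (auto simp: mean_weight_def divide_le_eq_1 add_pos_nonneg)

lemma mean_weight_antimono: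
  assumes "0 < s" "s \<le> t" shows "mean_weight t g \<le> mean_weight s g"
  using assms by (auto simp: mean_weight_def add_pos_nonneg intro!: divide_left_mono)

text \<open>After expanding the squares, the terms quadratic in the weights cancel. What remains is linear in
  the weights: a sum of \<open>v i - (y i - \<theta> i)\<^sup>2\<close> with constant weight \<open>1\<close>, two weighted sums whose
  summands will be independent and centred, and a remainder of order \<open>1 / p\<close>.\<close>
lemma URE_minus_loss:
  fixes y \<theta> \<tau> :: "nat \<Rightarrow> real" and p :: nat and g :: ennreal and F :: nef_qvf
  assumes "\<And>i. i \<in> {1..p} \<Longrightarrow> 0 < \<tau> i"
  defines "m \<equiv> grand_mean p y" and "w \<equiv> \<lambda>i. mean_weight (\<tau> i) g"
    and "v \<equiv> \<lambda>i. var_fun F (y i) / (\<tau> i + nu2 F)"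
  shows "URE_PG F \<tau> p y g - sq_loss p \<theta> (shrink_gm \<tau> p g y) =
    1 / p * (\<Sum>i\<in>{1..p}. 1 * (v i - (y i - \<theta> i)\<^sup>2))
    + 2 / p * ((\<Sum>i\<in>{1..p}. w i * ((y i - \<theta> i) * y i - v i))
       - m * (\<Sum>i\<in>{1..p}. w i * (y i - \<theta> i)) + 1 / p * (\<Sum>i\<in>{1..p}. w i * v i))"
proof -
  have "URE_PG F \<tau> p y g - sq_loss p \<theta> (shrink_gm \<tau> p g y) =
    1 / p * (\<Sum>i\<in>{1..p}. (w i)\<^sup>2 * (y i - m)\<^sup>2 + (1 - 2 * (1 - 1 / p) * w i) * v i
       - ((1 - w i) * y i + w i * m - \<theta> i)\<^sup>2)"
    unfolding URE_PG_def sq_loss_def shrink_gm_def w_def v_def m_def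
    using assms(1) by (simp add: obs_weight_eq sum_subtractf diff_divide_distrib)
  also have "(\<Sum>i\<in>{1..p}. (w i)\<^sup>2 * (y i - m)\<^sup>2 + (1 - 2 * (1 - 1 / p) * w i) * v i
       - ((1 - w i) * y i + w i * m - \<theta> i)\<^sup>2)
    = (\<Sum>i\<in>{1..p}. 1 * (v i - (y i - \<theta> i)\<^sup>2) + 2 * (w i * ((y i - \<theta> i) * y i - v i))
       - 2 * m * (w i * (y i - \<theta> i)) + 2 / p * (w i * v i))"
    by (intro sum.cong refl) (simp add: power2_eq_square algebra_simps)
  also have "\<dots> = (\<Sum>i\<in>{1..p}. 1 * (v i - (y i - \<theta> i)\<^sup>2)) + 2 * (\<Sum>i\<in>{1..p}. w i * ((y i - \<theta> i) * y i - v i))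
       - 2 * m * (\<Sum>i\<in>{1..p}. w i * (y i - \<theta> i)) + 2 / p * (\<Sum>i\<in>{1..p}. w i * v i)"
    by (simp only: sum.distrib sum_subtractf sum_distrib_left)
  also have "1 / p * \<dots> = 1 / p * (\<Sum>i\<in>{1..p}. 1 * (v i - (y i - \<theta> i)\<^sup>2))
    + 2 / p * ((\<Sum>i\<in>{1..p}. w i * ((y i - \<theta> i) * y i - v i))
       - m * (\<Sum>i\<in>{1..p}. w i * (y i - \<theta> i)) + 1 / p * (\<Sum>i\<in>{1..p}. w i * v i))"
    by (simp add: algebra_simps)
  finally show ?thesis .
qed

lemma plug_in_variance_bound:
  assumes "0 < c" "c \<le> t + nu2 F"
  shows "\<bar>var_fun F y / (t + nu2 F)\<bar> \<le> (\<bar>nu0 F\<bar> + \<bar>nu1 F\<bar> + \<bar>nu2 F\<bar>) / c * (1 + y\<^sup>2)"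
proof -
  have y: "\<bar>y\<bar> \<le> 1 + y\<^sup>2" using sum_squares_bound[of 1 "\<bar>y\<bar>"] by simp
  have "\<bar>var_fun F y\<bar> \<le> \<bar>nu0 F\<bar> + \<bar>nu1 F\<bar> * \<bar>y\<bar> + \<bar>nu2 F\<bar> * y\<^sup>2"
    unfolding var_fun_def by (intro order_trans[OF abs_triangle_ineq] add_mono) (auto simp: abs_mult)
  also have "\<dots> \<le> \<bar>nu0 F\<bar> * (1 + y\<^sup>2) + \<bar>nu1 F\<bar> * (1 + y\<^sup>2) + \<bar>nu2 F\<bar> * (1 + y\<^sup>2)"
    using y by (intro add_mono mult_left_mono) (auto simp: distrib_left)
  finally have "\<bar>var_fun F y\<bar> \<le> (\<bar>nu0 F\<bar> + \<bar>nu1 F\<bar> + \<bar>nu2 F\<bar>) * (1 + y\<^sup>2)" by (simp add: distrib_right)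
  then have "\<bar>var_fun F y\<bar> / (t + nu2 F) \<le> (\<bar>nu0 F\<bar> + \<bar>nu1 F\<bar> + \<bar>nu2 F\<bar>) * (1 + y\<^sup>2) / c"
    using assms by (intro frac_le) auto
  then show ?thesis using assms by (simp add: abs_divide)
qed

lemma (in prob_space) square_expectation_le:
  fixes X :: "'a \<Rightarrow> real"
  assumes "integrable M X" "integrable M (\<lambda>\<omega>. (X \<omega>)\<^sup>2)"
  shows "(expectation X)\<^sup>2 \<le> expectation (\<lambda>\<omega>. (X \<omega>)\<^sup>2)"
proof -
  have "0 \<le> variance X" by (rule variance_positive)
  also have "\<dots> = expectation (\<lambda>\<omega>. (X \<omega>)\<^sup>2) - (expectation X)\<^sup>2" by (rule variance_eq[OF assms])
  finally show ?thesis by simp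
qed

lemma (in prob_space) expectation_le_sqrt_second_moment:
  assumes "G \<in> borel_measurable M" "integrable M (\<lambda>\<omega>. (G \<omega>)\<^sup>2)" "expectation (\<lambda>\<omega>. (G \<omega>)\<^sup>2) \<le> b"
  shows "integrable M G" and "expectation G \<le> sqrt b"
proof -
  show G: "integrable M G" using square_integrable_imp_integrable assms by blast
  have "(expectation G)\<^sup>2 \<le> b"
    using square_expectation_le[OF G assms(2)] assms(3) by simp
  then show "expectation G \<le> sqrt b" by (rule real_le_rsqrt)
qed

lemma sum_le_sqrt_of_squares:
  fixes a b :: "nat \<Rightarrow> real"
  assumes "\<And>i. i \<in> {1..p} \<Longrightarrow> (a i)\<^sup>2 \<le> b i"
  shows "(\<Sum>i=1..p. a i) \<le> sqrt (real p * (\<Sum>i=1..p. b i))"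
proof (rule real_le_rsqrt)
  have "(\<Sum>i=1..p. a i)\<^sup>2 \<le> (\<Sum>i=1..p. (a i)\<^sup>2) * real p"
    using sum_squared_le_sum_of_squares[of a "{1..p}"] by simp
  also have "\<dots> \<le> (\<Sum>i=1..p. b i) * real p" using assms by (intro mult_right_mono sum_mono) auto
  finally show "(\<Sum>i=1..p. a i)\<^sup>2 \<le> real p * (\<Sum>i=1..p. b i)" by (simp add: mult.commute)
qed

text \<open>The growth constant of \<open>y \<mapsto> var_fun F y / (\<tau> + nu2 F)\<close> relative to \<open>1 + y\<^sup>2\<close> when
  \<open>\<tau> + nu2 F \<ge> c\<close>.\<close>
definition plug_in_coeff :: "nef_qvf \<Rightarrow> real \<Rightarrow> real" where
  "plug_in_coeff F c = (\<bar>nu0 F\<bar> + \<bar>nu1 F\<bar> + \<bar>nu2 F\<bar>) / c"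

text \<open>A bound for the expected uniform error with \<open>p\<close> observations whose fourth moments add up to \<open>b\<close>.
  The three terms stem from the two centred sums with quadratic summands, from the grand mean times
  the centred linear sum, and from the remainder of order \<open>1 / p\<close>; all vanish when \<open>b / p\<^sup>2\<close> does.\<close>
definition URE_error_bound :: "real \<Rightarrow> real \<Rightarrow> real \<Rightarrow> real" where
  "URE_error_bound K p b =
     12 * sqrt (3 * (K + 2)\<^sup>2 * (p + 2 * b)) / p + 17 * sqrt b / p + 2 * K * (2 * p + b) / p\<^sup>2"

text \<open>For statistics of at most quadratic growth in \<open>Y\<close>, the fourth moment of \<open>Y\<close> controls the second
  moment. The hypothesis on \<open>t\<close> holds for the mean of \<open>Y\<close>.\<close>
lemma (in prob_space) quadratic_statistic_square:
  fixes Y U :: "'a \<Rightarrow> real" and t :: real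
  assumes U: "U \<in> borel_measurable M" and Y4: "integrable M (\<lambda>\<omega>. (Y \<omega>) ^ 4)"
    and bound: "\<And>\<omega>. \<bar>U \<omega>\<bar> \<le> C * (1 + (Y \<omega>)\<^sup>2 + t\<^sup>2)" and t: "t ^ 4 \<le> expectation (\<lambda>\<omega>. (Y \<omega>) ^ 4)"
  shows "integrable M (\<lambda>\<omega>. (U \<omega>)\<^sup>2)"
    and "expectation (\<lambda>\<omega>. (U \<omega>)\<^sup>2) \<le> 3 * C\<^sup>2 * (1 + 2 * expectation (\<lambda>\<omega>. (Y \<omega>) ^ 4))"
proof -
  let ?B = "\<lambda>\<omega>. 3 * C\<^sup>2 * (1 + (Y \<omega>) ^ 4 + t ^ 4)"
  have B: "integrable M ?B" using Y4 by simp
  have le: "(U \<omega>)\<^sup>2 \<le> ?B \<omega>" for \<omega>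
  proof -
    have "(U \<omega>)\<^sup>2 \<le> (C * (1 + (Y \<omega>)\<^sup>2 + t\<^sup>2))\<^sup>2"
      using power_mono[OF bound abs_ge_zero, of \<omega> 2] by simp
    also have "\<dots> = C\<^sup>2 * (1 + (Y \<omega>)\<^sup>2 + t\<^sup>2)\<^sup>2" by (simp add: power_mult_distrib)
    also have "\<dots> \<le> C\<^sup>2 * (3 * (1\<^sup>2 + ((Y \<omega>)\<^sup>2)\<^sup>2 + (t\<^sup>2)\<^sup>2))"
    proof (rule mult_left_mono)
      have "(a + b + c)\<^sup>2 \<le> 3 * (a\<^sup>2 + b\<^sup>2 + c\<^sup>2)" for a b c :: real
        using zero_le_power2[of "a - b"] zero_le_power2[of "a - c"] zero_le_power2[of "b - c"]
        unfolding power2_eq_square by (simp add: algebra_simps)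
      then show "(1 + (Y \<omega>)\<^sup>2 + t\<^sup>2)\<^sup>2 \<le> 3 * (1\<^sup>2 + ((Y \<omega>)\<^sup>2)\<^sup>2 + (t\<^sup>2)\<^sup>2)" .
    qed simp
    finally show ?thesis by (simp add: algebra_simps)
  qed
  show I: "integrable M (\<lambda>\<omega>. (U \<omega>)\<^sup>2)"
    by (rule Bochner_Integration.integrable_bound[OF B])
      (use U order_trans[OF le abs_ge_self] in auto)
  have "expectation (\<lambda>\<omega>. (U \<omega>)\<^sup>2) \<le> expectation ?B" by (rule integral_mono[OF I B le])
  also have "\<dots> = 3 * C\<^sup>2 * (1 + expectation (\<lambda>\<omega>. (Y \<omega>) ^ 4) + t ^ 4)" using Y4 by (simp add: prob_space)
  also have "\<dots> \<le> 3 * C\<^sup>2 * (1 + 2 * expectation (\<lambda>\<omega>. (Y \<omega>) ^ 4))" using t by (intro mult_left_mono) auto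
  finally show "expectation (\<lambda>\<omega>. (U \<omega>)\<^sup>2) \<le> 3 * C\<^sup>2 * (1 + 2 * expectation (\<lambda>\<omega>. (Y \<omega>) ^ 4))" .
qed

text \<open>The weights \<open>mean_weight (\<tau> i) g\<close> lie in \<open>[0, 1]\<close> and decrease in \<open>\<tau> i\<close> for every \<open>g\<close>, the value
  \<open>\<infinity>\<close> included, so the envelope of the centred sums bounds the difference between the unbiased risk
  estimate and the loss for all \<open>g\<close> simultaneously.\<close>
theorem (in prob_space) URE_uniformly_close_to_loss:
  fixes Y :: "nat \<Rightarrow> 'a \<Rightarrow> real" and \<tau> \<theta> :: "nat \<Rightarrow> real"
  assumes p: "1 \<le> p" and ind: "indep_vars (\<lambda>_. borel) Y {1..p}"
    and Y4: "\<And>i. i \<in> {1..p} \<Longrightarrow> integrable M (\<lambda>\<omega>. (Y i \<omega>) ^ 4)"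
    and mean: "\<And>i. i \<in> {1..p} \<Longrightarrow> expectation (Y i) = \<theta> i"
    and second: "\<And>i. i \<in> {1..p} \<Longrightarrow> expectation (\<lambda>\<omega>. (Y i \<omega>)\<^sup>2) = (\<theta> i)\<^sup>2 + var_fun F (\<theta> i) / \<tau> i"
    and \<tau>: "\<And>i. i \<in> {1..p} \<Longrightarrow> 0 < \<tau> i"
    and c: "0 < c" "\<And>i. i \<in> {1..p} \<Longrightarrow> c \<le> \<tau> i + nu2 F"
  defines "b \<equiv> \<Sum>i=1..p. expectation (\<lambda>\<omega>. (Y i \<omega>) ^ 4)"
  obtains D where "integrable M D" "expectation D \<le> URE_error_bound (plug_in_coeff F c) p b"
    "\<And>\<omega> g. \<bar>URE_PG F \<tau> p (\<lambda>i. Y i \<omega>) g - sq_loss p \<theta> (shrink_gm \<tau> p g (\<lambda>i. Y i \<omega>))\<bar> \<le> D \<omega>"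
proof -
  define I where I: "I = {1..p}"
  define K where "K = plug_in_coeff F c"
  define b4 where "b4 i = expectation (\<lambda>\<omega>. (Y i \<omega>) ^ 4)" for i
  define v where "v i y = var_fun F y / (\<tau> i + nu2 F)" for i y
  define Z where "Z i \<omega> = Y i \<omega> - \<theta> i" for i \<omega>
  define U where "U i \<omega> = (Y i \<omega> - \<theta> i) * Y i \<omega> - v i (Y i \<omega>)" for i \<omega>
  define W where "W i \<omega> = v i (Y i \<omega>) - (Y i \<omega> - \<theta> i)\<^sup>2" for i \<omega>
  have rp: "0 < real p" using p by simp
  have K0: "0 \<le> K" using c by (simp add: K_def plug_in_coeff_def)
  have finI: "finite I" and cardI: "card I = p" by (simp_all add: I)
  have Y[measurable]: "Y i \<in> borel_measurable M" if "i \<in> I" for i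
    using ind that by (auto simp: indep_vars_def I)
  have v_meas[measurable]: "v i \<in> borel_measurable borel" for i
    unfolding v_def[abs_def] var_fun_def by measurable
  have v_bound: "\<bar>v i y\<bar> \<le> K * (1 + y\<^sup>2)" if "i \<in> I" for i y
    using plug_in_variance_bound[OF c(1) c(2), of i y] that unfolding v_def K_def plug_in_coeff_def I by auto
  have Y2: "integrable M (\<lambda>\<omega>. (Y i \<omega>)\<^sup>2)" if "i \<in> I" for i
    using square_integrable_imp_integrable[of "\<lambda>\<omega>. (Y i \<omega>)\<^sup>2"] Y4[of i] Y[OF that] that by (simp add: I)
  have Y1: "integrable M (Y i)" if "i \<in> I" for i
    using square_integrable_imp_integrable[OF Y[OF that] Y2[OF that]] .
  have EY2_sq: "(expectation (\<lambda>\<omega>. (Y i \<omega>)\<^sup>2))\<^sup>2 \<le> b4 i" if "i \<in> I" for i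
    using square_expectation_le[OF Y2[OF that]] Y4[of i] that by (simp add: I b4_def)
  have th2: "(\<theta> i)\<^sup>2 \<le> expectation (\<lambda>\<omega>. (Y i \<omega>)\<^sup>2)" if "i \<in> I" for i
    using square_expectation_le[OF Y1[OF that] Y2[OF that]] mean[of i] that by (simp add: I)
  have th4: "(\<theta> i) ^ 4 \<le> b4 i" if "i \<in> I" for i
    using order_trans[OF power_mono[OF th2[OF that], of 2] EY2_sq[OF that]] by simp
  have v1: "integrable M (\<lambda>\<omega>. v i (Y i \<omega>))"
    and Ev: "expectation (\<lambda>\<omega>. v i (Y i \<omega>)) = var_fun F (\<theta> i) / \<tau> i" if i: "i \<in> I" for i
  proof -
    show "integrable M (\<lambda>\<omega>. v i (Y i \<omega>))"
      unfolding v_def var_fun_def using Y1[OF i] Y2[OF i] by simp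
    have pos: "0 < \<tau> i" "0 < \<tau> i + nu2 F" using \<tau>[of i] c i by (fastforce simp: I)+
    have "expectation (\<lambda>\<omega>. v i (Y i \<omega>)) =
      (nu0 F + nu1 F * \<theta> i + nu2 F * ((\<theta> i)\<^sup>2 + var_fun F (\<theta> i) / \<tau> i)) / (\<tau> i + nu2 F)"
      unfolding v_def var_fun_def using Y1[OF i] Y2[OF i] mean[of i] second[of i] i
      by (simp add: I prob_space var_fun_def)
    also have "nu0 F + nu1 F * \<theta> i + nu2 F * ((\<theta> i)\<^sup>2 + var_fun F (\<theta> i) / \<tau> i)
       = var_fun F (\<theta> i) / \<tau> i * (\<tau> i + nu2 F)"
      using pos by (simp add: var_fun_def field_simps)
    finally show "expectation (\<lambda>\<omega>. v i (Y i \<omega>)) = var_fun F (\<theta> i) / \<tau> i" using pos by simp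
  qed
  \<comment> \<open>\<open>U\<close> and \<open>W\<close> are centred because \<open>v i (Y i)\<close> estimates the variance without bias: the extra
    \<open>nu2 F\<close> in its denominator accounts for the variance of \<open>Y i\<close> inside the square.\<close>
  have EZ: "expectation (Z i) = 0" and EU: "expectation (U i) = 0" and EW: "expectation (W i) = 0"
    and EZ2: "integrable M (\<lambda>\<omega>. (Z i \<omega>)\<^sup>2)" "expectation (\<lambda>\<omega>. (Z i \<omega>)\<^sup>2) \<le> expectation (\<lambda>\<omega>. (Y i \<omega>)\<^sup>2)"
    if i: "i \<in> I" for i
  proof -
    note ints = Y1[OF i] Y2[OF i] v1[OF i]
    note vals = mean[of i] second[of i] Ev[OF i]
    have i': "i \<in> {1..p}" using i by (simp add: I)
    show "expectation (Z i) = 0" unfolding Z_def using ints vals i' by (simp add: prob_space)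
    have "expectation (\<lambda>\<omega>. (Y i \<omega>)\<^sup>2 - \<theta> i * Y i \<omega> - v i (Y i \<omega>)) = 0"
      using ints vals i' by (simp add: power2_eq_square)
    then show "expectation (U i) = 0" unfolding U_def by (simp add: power2_eq_square left_diff_distrib)
    have Zexp: "(\<lambda>\<omega>. (Z i \<omega>)\<^sup>2) = (\<lambda>\<omega>. (Y i \<omega>)\<^sup>2 - 2 * \<theta> i * Y i \<omega> + (\<theta> i)\<^sup>2)"
      by (simp add: fun_eq_iff Z_def power2_diff mult_ac)
    show Z2: "integrable M (\<lambda>\<omega>. (Z i \<omega>)\<^sup>2)" unfolding Zexp using ints by simp
    have EZ2: "expectation (\<lambda>\<omega>. (Z i \<omega>)\<^sup>2) = var_fun F (\<theta> i) / \<tau> i"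
      unfolding Zexp using ints vals i' by (simp add: prob_space power2_eq_square)
    then show "expectation (\<lambda>\<omega>. (Z i \<omega>)\<^sup>2) \<le> expectation (\<lambda>\<omega>. (Y i \<omega>)\<^sup>2)" using vals i' by simp
    have "W i = (\<lambda>\<omega>. v i (Y i \<omega>) - (Z i \<omega>)\<^sup>2)" by (simp add: fun_eq_iff W_def Z_def)
    then show "expectation (W i) = 0" using ints vals i' Z2 EZ2 by simp
  qed
  have prod_bound: "\<bar>(y - t) * y\<bar> \<le> 2 * (y\<^sup>2 + t\<^sup>2)" "(y - t)\<^sup>2 \<le> 2 * (y\<^sup>2 + t\<^sup>2)" for y t :: real
  proof -
    show "(y - t)\<^sup>2 \<le> 2 * (y\<^sup>2 + t\<^sup>2)" using zero_le_power2[of "y + t"] by (simp add: power2_sum power2_diff)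
    have "\<bar>(y - t) * y\<bar> \<le> y\<^sup>2 + \<bar>t * y\<bar>"
      using abs_triangle_ineq4[of "y\<^sup>2" "t * y"] by (simp add: power2_eq_square left_diff_distrib)
    moreover have "\<bar>t * y\<bar> \<le> t\<^sup>2 + y\<^sup>2"
      using sum_squares_bound[of "\<bar>t\<bar>" "\<bar>y\<bar>"] zero_le_power2[of t] zero_le_power2[of y] unfolding abs_mult power2_abs by linarith
    ultimately show "\<bar>(y - t) * y\<bar> \<le> 2 * (y\<^sup>2 + t\<^sup>2)" using zero_le_power2[of t] unfolding distrib_left by linarith
  qed
  have comb: "\<bar>a\<bar> + \<bar>e\<bar> \<le> (K + 2) * (1 + y\<^sup>2 + t\<^sup>2)"
    if "\<bar>a\<bar> \<le> K * (1 + y\<^sup>2)" "\<bar>e\<bar> \<le> 2 * (y\<^sup>2 + t\<^sup>2)" for a e y t :: real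
  proof -
    have "(K + 2) * (1 + y\<^sup>2 + t\<^sup>2) = K * (1 + y\<^sup>2) + 2 * (y\<^sup>2 + t\<^sup>2) + K * t\<^sup>2 + 2" by (simp add: algebra_simps)
    moreover have "0 \<le> K * t\<^sup>2" using K0 by simp
    ultimately show ?thesis using that by linarith
  qed
  have U_bound: "\<bar>U i \<omega>\<bar> \<le> (K + 2) * (1 + (Y i \<omega>)\<^sup>2 + (\<theta> i)\<^sup>2)" if "i \<in> I" for i \<omega>
    unfolding U_def using comb[OF v_bound[OF that] prod_bound(1)[of "Y i \<omega>" "\<theta> i"]] abs_triangle_ineq4 by (smt (verit))
  have W_bound: "\<bar>W i \<omega>\<bar> \<le> (K + 2) * (1 + (Y i \<omega>)\<^sup>2 + (\<theta> i)\<^sup>2)" if "i \<in> I" for i \<omega>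
    unfolding W_def using comb[OF v_bound[OF that], of "(Y i \<omega> - \<theta> i)\<^sup>2" "Y i \<omega>" "\<theta> i"] prod_bound(2)[of "Y i \<omega>" "\<theta> i"]
      abs_triangle_ineq4[of "v i (Y i \<omega>)" "(Y i \<omega> - \<theta> i)\<^sup>2"] by simp
  have indI: "indep_vars (\<lambda>_. borel) Y I" using ind by (simp add: I)
  have indZ: "indep_vars (\<lambda>_. borel) Z I" unfolding Z_def by (rule indep_vars_compose2[OF indI]) measurable
  have indU: "indep_vars (\<lambda>_. borel) U I" unfolding U_def by (rule indep_vars_compose2[OF indI]) measurable
  have indW: "indep_vars (\<lambda>_. borel) W I" unfolding W_def by (rule indep_vars_compose2[OF indI]) measurable
  have U_meas: "U i \<in> borel_measurable M" and W_meas: "W i \<in> borel_measurable M" if "i \<in> I" for i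
    using indU indW that by (auto simp: indep_vars_def)
  note U2 = quadratic_statistic_square[OF U_meas _ U_bound, OF _ Y4[folded I] _ th4[unfolded b4_def]]
  note W2 = quadratic_statistic_square[OF W_meas _ W_bound, OF _ Y4[folded I] _ th4[unfolded b4_def]]
  define S where "S = 3 * (K + 2)\<^sup>2 * (p + 2 * b)"
  have b: "b = (\<Sum>i\<in>I. b4 i)" by (simp add: b_def b4_def I)
  have S_eq: "(\<Sum>i\<in>I. 3 * (K + 2)\<^sup>2 * (1 + 2 * expectation (\<lambda>\<omega>. (Y i \<omega>) ^ 4))) = S"
    unfolding S_def b b4_def using cardI by (simp add: sum_distrib_left[symmetric] sum.distrib)
  obtain GU where GU: "GU \<in> borel_measurable M" "integrable M (\<lambda>\<omega>. (GU \<omega>)\<^sup>2)"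
    "expectation (\<lambda>\<omega>. (GU \<omega>)\<^sup>2) \<le> 16 * (\<Sum>i\<in>I. expectation (\<lambda>x. (U i x)\<^sup>2))" "\<And>\<omega>. 0 \<le> GU \<omega>"
    "\<And>w \<omega>. (\<And>i. i \<in> I \<Longrightarrow> 0 \<le> w i \<and> w i \<le> 1) \<Longrightarrow>
       (\<And>i j. i \<in> I \<Longrightarrow> j \<in> I \<Longrightarrow> \<tau> i \<le> \<tau> j \<Longrightarrow> w j \<le> w i) \<Longrightarrow> \<bar>\<Sum>i\<in>I. w i * U i \<omega>\<bar> \<le> GU \<omega>"
    by (rule antimono_weighted_sums_envelope[OF indU finI U2(1) EU, of \<tau>]) (assumption | blast)+
  obtain GW where GW: "GW \<in> borel_measurable M" "integrable M (\<lambda>\<omega>. (GW \<omega>)\<^sup>2)"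
    "expectation (\<lambda>\<omega>. (GW \<omega>)\<^sup>2) \<le> 16 * (\<Sum>i\<in>I. expectation (\<lambda>x. (W i x)\<^sup>2))" "\<And>\<omega>. 0 \<le> GW \<omega>"
    "\<And>w \<omega>. (\<And>i. i \<in> I \<Longrightarrow> 0 \<le> w i \<and> w i \<le> 1) \<Longrightarrow>
       (\<And>i j. i \<in> I \<Longrightarrow> j \<in> I \<Longrightarrow> \<tau> i \<le> \<tau> j \<Longrightarrow> w j \<le> w i) \<Longrightarrow> \<bar>\<Sum>i\<in>I. w i * W i \<omega>\<bar> \<le> GW \<omega>"
    by (rule antimono_weighted_sums_envelope[OF indW finI W2(1) EW, of \<tau>]) (assumption | blast)+
  obtain GZ where GZ: "GZ \<in> borel_measurable M" "integrable M (\<lambda>\<omega>. (GZ \<omega>)\<^sup>2)"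
    "expectation (\<lambda>\<omega>. (GZ \<omega>)\<^sup>2) \<le> 16 * (\<Sum>i\<in>I. expectation (\<lambda>x. (Z i x)\<^sup>2))" "\<And>\<omega>. 0 \<le> GZ \<omega>"
    "\<And>w \<omega>. (\<And>i. i \<in> I \<Longrightarrow> 0 \<le> w i \<and> w i \<le> 1) \<Longrightarrow>
       (\<And>i j. i \<in> I \<Longrightarrow> j \<in> I \<Longrightarrow> \<tau> i \<le> \<tau> j \<Longrightarrow> w j \<le> w i) \<Longrightarrow> \<bar>\<Sum>i\<in>I. w i * Z i \<omega>\<bar> \<le> GZ \<omega>"
    by (rule antimono_weighted_sums_envelope[OF indZ finI EZ2(1) EZ, of \<tau>]) (assumption | blast)+
  define m where "m \<omega> = grand_mean p (\<lambda>i. Y i \<omega>)" for \<omega>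
  define T where "T = (\<Sum>i\<in>I. expectation (\<lambda>\<omega>. (Y i \<omega>)\<^sup>2))"
  have EGU: "integrable M GU" "expectation GU \<le> 4 * sqrt S"
  proof -
    have "expectation (\<lambda>\<omega>. (GU \<omega>)\<^sup>2) \<le> 16 * S"
      using order_trans[OF GU(3) mult_left_mono[OF sum_mono[OF U2(2)]]] S_eq by simp
    from expectation_le_sqrt_second_moment[OF GU(1,2) this]
    show "integrable M GU" "expectation GU \<le> 4 * sqrt S" by (simp_all add: real_sqrt_mult)
  qed
  have EGW: "integrable M GW" "expectation GW \<le> 4 * sqrt S"
  proof -
    have "expectation (\<lambda>\<omega>. (GW \<omega>)\<^sup>2) \<le> 16 * S"
      using order_trans[OF GW(3) mult_left_mono[OF sum_mono[OF W2(2)]]] S_eq by simp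
    from expectation_le_sqrt_second_moment[OF GW(1,2) this]
    show "integrable M GW" "expectation GW \<le> 4 * sqrt S" by (simp_all add: real_sqrt_mult)
  qed
  have EGZ: "expectation (\<lambda>\<omega>. (GZ \<omega>)\<^sup>2) \<le> 16 * T"
    unfolding T_def using order_trans[OF GZ(3) mult_left_mono[OF sum_mono[OF EZ2(2)]]] by simp
  have T: "T \<le> sqrt (real p * b)"
    unfolding T_def b I by (rule sum_le_sqrt_of_squares) (use EY2_sq I in auto)
  have m_sq: "(m \<omega>)\<^sup>2 \<le> (\<Sum>i\<in>I. (Y i \<omega>)\<^sup>2) / p" for \<omega>
  proof -
    have "(\<Sum>i\<in>I. Y i \<omega>)\<^sup>2 \<le> (\<Sum>i\<in>I. (Y i \<omega>)\<^sup>2) * p"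
      using sum_squared_le_sum_of_squares[of "\<lambda>i. Y i \<omega>" I] cardI by simp
    then show ?thesis using rp
      by (simp add: m_def grand_mean_def I power_divide power2_eq_square[of "real p"] field_simps)
  qed
  \<comment> \<open>\<open>H\<close> dominates the product of the grand mean and the envelope of the linear sums; the weight
    \<open>sqrt p\<close> balances the bounds \<open>T / p\<close> and \<open>16 * T\<close> on the second moments of the two factors.\<close>
  define H where "H \<omega> = (sqrt p * ((\<Sum>i\<in>I. (Y i \<omega>)\<^sup>2) / p) + (GZ \<omega>)\<^sup>2 / sqrt p) / 2" for \<omega>
  have H_bound: "\<bar>m \<omega>\<bar> * GZ \<omega> \<le> H \<omega>" for \<omega>
  proof -
    have "\<bar>m \<omega>\<bar> * GZ \<omega> \<le> (sqrt p * (m \<omega>)\<^sup>2 + (GZ \<omega>)\<^sup>2 / sqrt p) / 2"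
    proof -
      define q where "q = sqrt (sqrt (real p))"
      have q: "0 < q" "q\<^sup>2 = sqrt (real p)" using rp by (simp_all add: q_def)
      have "2 * (q * \<bar>m \<omega>\<bar>) * (GZ \<omega> / q) \<le> (q * \<bar>m \<omega>\<bar>)\<^sup>2 + (GZ \<omega> / q)\<^sup>2" by (rule sum_squares_bound)
      then show ?thesis using q by (simp add: power_mult_distrib power_divide)
    qed
    also have "\<dots> \<le> H \<omega>" unfolding H_def
      using m_sq[of \<omega>] by (intro divide_right_mono add_right_mono mult_left_mono) auto
    finally show ?thesis .
  qed
  have EH: "integrable M H" "expectation H \<le> 17 / 2 * sqrt b"
  proof -
    show "integrable M H" unfolding H_def using Y2 GZ(2) by simp
    have "expectation H = (sqrt p * (T / p) + expectation (\<lambda>\<omega>. (GZ \<omega>)\<^sup>2) / sqrt p) / 2"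
      unfolding H_def T_def using Y2 GZ(2) by simp
    also have "sqrt p * (T / p) = T / sqrt p"
      using rp real_sqrt_mult_self[of "real p"] by (simp add: field_simps)
    also have "(T / sqrt p + expectation (\<lambda>\<omega>. (GZ \<omega>)\<^sup>2) / sqrt p) / 2 \<le> (T / sqrt p + 16 * T / sqrt p) / 2"
      using EGZ rp by (intro divide_right_mono add_left_mono) auto
    also have "\<dots> = 17 / 2 * (T / sqrt p)" by simp
    also have "\<dots> \<le> 17 / 2 * (sqrt (p * b) / sqrt p)"
      using T by (intro mult_left_mono divide_right_mono) auto
    also have "sqrt (p * b) / sqrt p = sqrt b" using rp by (simp add: real_sqrt_mult)
    finally show "expectation H \<le> 17 / 2 * sqrt b" .
  qed
  define R where "R \<omega> = (\<Sum>i\<in>I. \<bar>v i (Y i \<omega>)\<bar>)" for \<omega>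
  have ER: "integrable M R" "expectation R \<le> K * (2 * p + b)"
  proof -
    show "integrable M R" unfolding R_def using v1 by simp
    have each: "expectation (\<lambda>\<omega>. \<bar>v i (Y i \<omega>)\<bar>) \<le> K * (2 + b4 i)" if i: "i \<in> I" for i
    proof -
      have "expectation (\<lambda>\<omega>. \<bar>v i (Y i \<omega>)\<bar>) \<le> expectation (\<lambda>\<omega>. K * (2 + (Y i \<omega>) ^ 4))"
      proof (rule integral_mono)
        show "integrable M (\<lambda>\<omega>. K * (2 + (Y i \<omega>) ^ 4))" using Y4[of i] i by (simp add: I)
        fix \<omega>
        have "(Y i \<omega>)\<^sup>2 \<le> 1 + (Y i \<omega>) ^ 4"
        proof -
          have "2 * (Y i \<omega>)\<^sup>2 \<le> 1 + (Y i \<omega>) ^ 4" using sum_squares_bound[of 1 "(Y i \<omega>)\<^sup>2"] by simp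
          then show ?thesis using zero_le_power2[of "Y i \<omega>"] by linarith
        qed
        then have "K * (1 + (Y i \<omega>)\<^sup>2) \<le> K * (2 + (Y i \<omega>) ^ 4)" using K0 by (intro mult_left_mono) auto
        with v_bound[OF i, of "Y i \<omega>"] show "\<bar>v i (Y i \<omega>)\<bar> \<le> K * (2 + (Y i \<omega>) ^ 4)" by linarith
      qed (use v1[OF i] in simp)
      also have "\<dots> = K * (2 + b4 i)" using Y4[of i] i by (simp add: I b4_def prob_space)
      finally show ?thesis .
    qed
    have "expectation R = (\<Sum>i\<in>I. expectation (\<lambda>\<omega>. \<bar>v i (Y i \<omega>)\<bar>))" unfolding R_def using v1 by simp
    also have "\<dots> \<le> (\<Sum>i\<in>I. K * (2 + b4 i))" by (intro sum_mono each)
    also have "\<dots> = K * (2 * p + b)" using cardI by (simp add: b sum_distrib_left[symmetric] sum.distrib)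
    finally show "expectation R \<le> K * (2 * p + b)" .
  qed
  define D where "D \<omega> = 1 / p * GW \<omega> + 2 / p * (GU \<omega> + H \<omega> + 1 / p * R \<omega>)" for \<omega>
  show ?thesis
  proof (rule that[of D])
    show "integrable M D" unfolding D_def using EGU EGW EH ER by simp
    have "expectation D = 1 / p * expectation GW + 2 / p * (expectation GU + expectation H + 1 / p * expectation R)"
      unfolding D_def using EGU EGW EH ER by simp
    also have "\<dots> \<le> 1 / p * (4 * sqrt S) + 2 / p * (4 * sqrt S + 17 / 2 * sqrt b + 1 / p * (K * (2 * p + b)))"
      using EGU EGW EH ER by (intro add_mono mult_left_mono) auto
    also have "\<dots> = URE_error_bound K p b"
    proof -
      have "1 / p * (4 * x) + 2 / p * (4 * x + 17 / 2 * y + 1 / p * (K * z)) = 12 * x / p + 17 * y / p + 2 * K * z / p\<^sup>2"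
        for x y z :: real using rp by (simp add: power2_eq_square field_simps)
      then show ?thesis by (simp only: URE_error_bound_def S_def of_nat_power of_nat_mult of_nat_numeral)
    qed
    finally show "expectation D \<le> URE_error_bound (plug_in_coeff F c) p b" by (simp add: K_def)
    fix \<omega> g
    let ?w = "\<lambda>i. mean_weight (\<tau> i) g"
    have w: "0 \<le> ?w i \<and> ?w i \<le> 1" if "i \<in> I" for i
      using mean_weight_range \<tau> that by (simp add: I)
    have w_anti: "?w j \<le> ?w i" if "i \<in> I" "j \<in> I" "\<tau> i \<le> \<tau> j" for i j
      using mean_weight_antimono \<tau> that by (simp add: I)
    have 1: "\<bar>\<Sum>i\<in>I. 1 * W i \<omega>\<bar> \<le> GW \<omega>" by (rule GW(5)) auto
    have 2: "\<bar>\<Sum>i\<in>I. ?w i * U i \<omega>\<bar> \<le> GU \<omega>" by (rule GU(5)) (auto simp: w w_anti)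
    have 3: "\<bar>\<Sum>i\<in>I. ?w i * Z i \<omega>\<bar> \<le> GZ \<omega>" by (rule GZ(5)) (auto simp: w w_anti)
    then have 3: "\<bar>m \<omega> * (\<Sum>i\<in>I. ?w i * Z i \<omega>)\<bar> \<le> H \<omega>"
      unfolding abs_mult by (intro order_trans[OF mult_left_mono H_bound]) auto
    have 4: "\<bar>\<Sum>i\<in>I. ?w i * v i (Y i \<omega>)\<bar> \<le> R \<omega>"
      unfolding R_def using w by (intro order_trans[OF sum_abs] sum_mono) (auto simp: abs_mult mult_left_le_one_le)
    let ?A = "\<Sum>i\<in>I. 1 * W i \<omega>" and ?B = "\<Sum>i\<in>I. ?w i * U i \<omega>"
      and ?C = "m \<omega> * (\<Sum>i\<in>I. ?w i * Z i \<omega>)" and ?E = "\<Sum>i\<in>I. ?w i * v i (Y i \<omega>)"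
    have eq: "URE_PG F \<tau> p (\<lambda>i. Y i \<omega>) g - sq_loss p \<theta> (shrink_gm \<tau> p g (\<lambda>i. Y i \<omega>))
      = 1 / p * ?A + 2 / p * (?B - ?C + 1 / p * ?E)"
      unfolding W_def U_def Z_def v_def m_def I by (rule URE_minus_loss) (rule \<tau>)
    have "\<bar>1 / p * ?A + 2 / p * (?B - ?C + 1 / p * ?E)\<bar> \<le> 1 / p * \<bar>?A\<bar> + 2 / p * (\<bar>?B\<bar> + \<bar>?C\<bar> + 1 / p * \<bar>?E\<bar>)"
    proof -
      have *: "\<bar>1 / p * A + 2 / p * (B - C + 1 / p * E)\<bar> \<le> 1 / p * \<bar>A\<bar> + 2 / p * (\<bar>B\<bar> + \<bar>C\<bar> + 1 / p * \<bar>E\<bar>)"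
        for A B C E :: real
      proof -
        have "\<bar>B - C + 1 / p * E\<bar> \<le> \<bar>B\<bar> + \<bar>C\<bar> + \<bar>1 / p * E\<bar>" by linarith
        then have "2 / p * \<bar>B - C + 1 / p * E\<bar> \<le> 2 / p * (\<bar>B\<bar> + \<bar>C\<bar> + \<bar>1 / p * E\<bar>)"
          by (rule mult_left_mono) simp
        moreover have "\<bar>2 / p * (B - C + 1 / p * E)\<bar> = 2 / p * \<bar>B - C + 1 / p * E\<bar>"
          "\<bar>1 / p * A\<bar> = 1 / p * \<bar>A\<bar>" "\<bar>1 / p * E\<bar> = 1 / p * \<bar>E\<bar>"
          unfolding abs_mult by simp_all
        ultimately show ?thesis
          using abs_triangle_ineq[of "1 / p * A" "2 / p * (B - C + 1 / p * E)"] by (simp only:)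
      qed
      show ?thesis by (rule *)
    qed
    also have "\<dots> \<le> D \<omega>" unfolding D_def
      by (intro add_mono mult_left_mono 1 2 3 4) simp_all
    finally show "\<bar>URE_PG F \<tau> p (\<lambda>i. Y i \<omega>) g - sq_loss p \<theta> (shrink_gm \<tau> p g (\<lambda>i. Y i \<omega>))\<bar> \<le> D \<omega>"
      unfolding eq .
  qed
qed

section \<open>Growth conditions\<close>

lemma URE_error_bound_tendsto_0:
  assumes "(\<lambda>p. b p / (real p)\<^sup>2) \<longlonglongrightarrow> 0"
  shows "(\<lambda>p. URE_error_bound K (real p) (b p)) \<longlonglongrightarrow> 0"
proof -
  let ?L = "3 * (K + 2)\<^sup>2"
  have inv: "(\<lambda>p. 1 / real p) \<longlonglongrightarrow> 0" by (rule lim_1_over_n)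
  have "(\<lambda>p. 12 * sqrt (?L * (1 / real p + 2 * (b p / (real p)\<^sup>2))) + 17 * sqrt (b p / (real p)\<^sup>2)
      + 2 * K * (2 * (1 / real p) + b p / (real p)\<^sup>2)) \<longlonglongrightarrow>
      12 * sqrt (?L * (0 + 2 * 0)) + 17 * sqrt 0 + 2 * K * (2 * 0 + 0)"
    by (intro tendsto_intros inv assms)
  moreover have "\<forall>\<^sub>F p in sequentially. 12 * sqrt (?L * (1 / real p + 2 * (b p / (real p)\<^sup>2))) + 17 * sqrt (b p / (real p)\<^sup>2)
      + 2 * K * (2 * (1 / real p) + b p / (real p)\<^sup>2) = URE_error_bound K (real p) (b p)"
    using eventually_gt_at_top[of 0]
  proof eventually_elim
    case (elim p)
    then have p: "0 < real p" by simp
    have "sqrt (?L * (1 / real p + 2 * (b p / (real p)\<^sup>2))) = sqrt (?L * (real p + 2 * b p) / (real p)\<^sup>2)"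
      using p by (simp add: power2_eq_square field_simps)
    also have "\<dots> = sqrt (?L * (real p + 2 * b p)) / real p" using p by (simp add: real_sqrt_divide)
    finally have 1: "sqrt (?L * (1 / real p + 2 * (b p / (real p)\<^sup>2))) = sqrt (?L * (real p + 2 * b p)) / real p" .
    have 2: "sqrt (b p / (real p)\<^sup>2) = sqrt (b p) / real p" using p by (simp add: real_sqrt_divide)
    have 3: "2 * (1 / real p) + b p / (real p)\<^sup>2 = (2 * real p + b p) / (real p)\<^sup>2"
      using p by (simp add: power2_eq_square field_simps)
    show ?case unfolding 1 2 3 by (simp add: URE_error_bound_def)
  qed
  ultimately show ?thesis by (simp add: Lim_transform_eventually)
qed

text \<open>A bound on the third powers is enough: each \<open>a i\<close> is at most the cube root of \<open>C * p\<close>, so the fourth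
  powers add up to at most a multiple of \<open>p\<close> to the power \<open>4 / 3\<close>. This is why a condition on third
  powers suffices for the Poisson family.\<close>
lemma sum_fourth_powers_small:
  fixes a :: "nat \<Rightarrow> real"
  assumes a: "\<And>i. 0 \<le> a i" and O: "(\<lambda>p. \<Sum>i=1..p. a i ^ 3) \<in> O(\<lambda>p. real p)"
  shows "(\<lambda>p. (\<Sum>i=1..p. a i ^ 4) / (real p)\<^sup>2) \<longlonglongrightarrow> 0"
proof -
  from O obtain C where C: "0 < C" and ev: "\<forall>\<^sub>F p in sequentially. norm (\<Sum>i=1..p. a i ^ 3) \<le> C * norm (real p)"
    by (elim landau_o.bigE)
  have "(\<lambda>p. C * (1 / real p) * (1 / real p)) \<longlonglongrightarrow> C * 0 * 0" by (intro tendsto_intros lim_1_over_n)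
  from tendsto_mult_left[OF tendsto_real_root[OF this, of 3], of C]
  have lim: "(\<lambda>p. C * root 3 (C / real p / real p)) \<longlonglongrightarrow> 0" by simp
  show ?thesis
  proof (rule tendsto_sandwich[OF _ _ tendsto_const lim])
    show "\<forall>\<^sub>F p in sequentially. 0 \<le> (\<Sum>i=1..p. a i ^ 4) / (real p)\<^sup>2"
      using a by (intro always_eventually allI divide_nonneg_nonneg sum_nonneg) auto
    show "\<forall>\<^sub>F p in sequentially. (\<Sum>i=1..p. a i ^ 4) / (real p)\<^sup>2 \<le> C * root 3 (C / real p / real p)"
      using ev eventually_gt_at_top[of 0]
    proof eventually_elim
      case (elim p)
      then have p: "0 < real p" by simp
      define r where "r = root 3 (C * p)"
      have r0: "0 \<le> r" using C by (simp add: r_def)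
      have S: "(\<Sum>i=1..p. a i ^ 3) \<le> C * p" using elim by simp
      have ai: "a i \<le> r" if "i \<in> {1..p}" for i
      proof -
        have "a i ^ 3 \<le> (\<Sum>i=1..p. a i ^ 3)" using that a by (intro member_le_sum) auto
        then have "root 3 (a i ^ 3) \<le> r" unfolding r_def using S by (intro real_root_le_mono) auto
        then show ?thesis using a[of i] by (simp add: real_root_power_cancel)
      qed
      have "(\<Sum>i=1..p. a i ^ 4) \<le> (\<Sum>i=1..p. r * a i ^ 3)"
      proof (rule sum_mono)
        fix i assume "i \<in> {1..p}"
        from mult_right_mono[OF ai[OF this], of "a i ^ 3"] a[of i]
        show "a i ^ 4 \<le> r * a i ^ 3" by (simp add: power_Suc[symmetric] numeral_eq_Suc)
      qed
      also have "\<dots> = r * (\<Sum>i=1..p. a i ^ 3)" by (simp add: sum_distrib_left)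
      also have "\<dots> \<le> r * (C * p)" using S r0 by (rule mult_left_mono)
      finally have "(\<Sum>i=1..p. a i ^ 4) / (real p)\<^sup>2 \<le> r * (C * p) / (real p)\<^sup>2"
        by (rule divide_right_mono) simp
      also have "\<dots> = C * (r / p)" using p by (simp add: power2_eq_square)
      also have "r / p = root 3 (C * p / (real p) ^ 3)"
        using p by (simp add: r_def real_root_divide real_root_power_cancel)
      also have "C * p / (real p) ^ 3 = C / real p / real p" using p by (simp add: power3_eq_cube)
      finally show ?case .
    qed
  qed
qed

lemma sum_bigo_of_termwise_bound:
  fixes f u :: "nat \<Rightarrow> real"
  assumes le: "\<And>i. 1 \<le> i \<Longrightarrow> \<bar>f i\<bar> \<le> A * (1 + u i)" and u: "(\<lambda>p. \<Sum>i=1..p. u i) \<in> O(\<lambda>p. real p)"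
  shows "(\<lambda>p. \<Sum>i=1..p. f i) \<in> O(\<lambda>p. real p)"
proof (rule landau_o.big_trans[OF landau_o.bigI[of 1]])
  show "\<forall>\<^sub>F p in sequentially. norm (\<Sum>i=1..p. f i) \<le> 1 * norm (A * (real p + (\<Sum>i=1..p. u i)))"
  proof (intro always_eventually allI)
    fix p
    have "\<bar>\<Sum>i=1..p. f i\<bar> \<le> (\<Sum>i=1..p. A * (1 + u i))"
      using le by (intro order_trans[OF sum_abs] sum_mono) auto
    also have "\<dots> = A * (real p + (\<Sum>i=1..p. u i))" by (simp add: sum_distrib_left[symmetric] sum.distrib)
    finally show "norm (\<Sum>i=1..p. f i) \<le> 1 * norm (A * (real p + (\<Sum>i=1..p. u i)))" by simp
  qed
  have "(\<lambda>p. real p + (\<Sum>i=1..p. u i)) \<in> O(\<lambda>p. real p)" by (intro sum_in_bigo u) simp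
  then show "(\<lambda>p. A * (real p + (\<Sum>i=1..p. u i))) \<in> O(\<lambda>p. real p)" by simp
qed simp

lemma one_plus_cube_le:
  fixes x :: real
  assumes "0 \<le> x"
  shows "(1 + x) ^ 3 \<le> 8 * (1 + x ^ 3)" "(1 + x) ^ 3 \<le> 8 * (1 + x ^ 4)"
proof -
  have "(1 + x) ^ 3 \<le> 8 \<or> 1 \<le> x \<and> (1 + x) ^ 3 \<le> 8 * x ^ 3"
  proof (cases "1 \<le> x")
    case True
    then have "(1 + x) ^ 3 \<le> (2 * x) ^ 3" by (intro power_mono) auto
    then show ?thesis using True by (simp add: power_mult_distrib)
  next
    case False
    then have "(1 + x) ^ 3 \<le> 2 ^ 3" using assms by (intro power_mono) auto
    then show ?thesis by simp
  qed
  moreover have "x ^ 3 \<le> x ^ 4" if "1 \<le> x" using that by (intro power_increasing) auto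
  moreover have "0 \<le> x ^ 3" "0 \<le> x ^ 4" using assms by simp_all
  ultimately show "(1 + x) ^ 3 \<le> 8 * (1 + x ^ 3)" "(1 + x) ^ 3 \<le> 8 * (1 + x ^ 4)" by (smt (verit))+
qed

lemma abs_one_plus_abs_cube_le:
  fixes x :: real
  shows "\<bar>(1 + \<bar>x\<bar>) ^ 3\<bar> \<le> 8 * (1 + x ^ 4)"
  using one_plus_cube_le(2)[of "\<bar>x\<bar>"] by simp

text \<open>The point at which the five families become indistinguishable: each family, under its
  own regularity conditions, provides a lower bound for the denominators \<open>\<tau> i + nu2 F\<close>, fourth moments of order
  \<open>(1 + \<bar>\<theta> i\<bar>)\<^sup>4\<close>, and linear growth of the sums of third powers.\<close>
lemma nef_regular_uniform_moments:
  fixes Y :: "nat \<Rightarrow> 'a \<Rightarrow> real" and \<tau> \<xi> \<theta> :: "nat \<Rightarrow> real"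
  assumes M: "prob_space M"
    and obs: "\<And>i. i \<ge> 1 \<Longrightarrow> nef_obs F M (\<tau> i) (\<xi> i) (Y i)"
    and \<theta>: "\<And>i. i \<ge> 1 \<Longrightarrow> \<theta> i = family_mean F (\<xi> i)"
    and reg: "nef_regular F \<tau> \<xi>"
  shows "\<exists>c C. 0 < c \<and> (\<forall>i\<ge>1. 0 < \<tau> i \<and> c \<le> \<tau> i + nu2 F) \<and>
    (\<forall>i\<ge>1. moments_up_to_four M (Y i) (\<theta> i) (var_fun F (\<theta> i) / \<tau> i) (C * (1 + \<bar>\<theta> i\<bar>))) \<and>
    (\<lambda>p. \<Sum>i=1..p. (1 + \<bar>\<theta> i\<bar>) ^ 3) \<in> O(\<lambda>p. real p)"
proof -
  have witness: ?thesis
    if "0 < c" "\<And>i. i \<ge> 1 \<Longrightarrow> 0 < \<tau> i" "\<And>i. i \<ge> 1 \<Longrightarrow> c \<le> \<tau> i + nu2 F"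
      "\<And>i. i \<ge> 1 \<Longrightarrow> moments_up_to_four M (Y i) (\<theta> i) (var_fun F (\<theta> i) / \<tau> i) (C * (1 + \<bar>\<theta> i\<bar>))"
      "(\<lambda>p. \<Sum>i=1..p. (1 + \<bar>\<theta> i\<bar>) ^ 3) \<in> O(\<lambda>p. real p)" for c C
    by (intro exI[of _ c] exI[of _ C] conjI allI impI that)
  have INF_le: "(INF i\<in>{1..}. \<tau> i) \<le> \<tau> i" if "\<And>i. i \<ge> 1 \<Longrightarrow> 0 < \<tau> i" "i \<ge> 1" for i
    using that by (intro cINF_lower bdd_belowI[of _ 0]) (auto simp: less_imp_le)
  show ?thesis
  proof (cases F)
    case BinomialFam
    have \<xi>: "0 < \<xi> i" "\<xi> i < 1" and two: "2 \<le> \<tau> i" if "i \<ge> 1" for i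
      using obs[OF that] reg that by (auto simp: BinomialFam)
    show ?thesis
    proof (rule witness[of 1 2])
      show "0 < \<tau> i" "1 \<le> \<tau> i + nu2 F" if "i \<ge> 1" for i using two[OF that] by (simp_all add: BinomialFam)
      show "moments_up_to_four M (Y i) (\<theta> i) (var_fun F (\<theta> i) / \<tau> i) (2 * (1 + \<bar>\<theta> i\<bar>))" if "i \<ge> 1" for i
        using binomial_moments[OF M, of "\<tau> i" "\<xi> i" "Y i"] obs[OF that] \<theta>[OF that] by (simp only: BinomialFam family_mean.simps)
      have "\<bar>(1 + \<bar>\<theta> i\<bar>) ^ 3\<bar> \<le> 8 * (1 + 0)" if "i \<ge> 1" for i
        using \<theta>[OF that] \<xi>[OF that] power_mono[of "1 + \<bar>\<theta> i\<bar>" 2 3] by (simp add: BinomialFam)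
      then show "(\<lambda>p. \<Sum>i=1..p. (1 + \<bar>\<theta> i\<bar>) ^ 3) \<in> O(\<lambda>p. real p)"
        by (rule sum_bigo_of_termwise_bound) auto
    qed simp
  next
    case PoissonFam
    define c where "c = (INF i\<in>{1..}. \<tau> i)"
    have pos: "0 < \<tau> i" "0 < \<xi> i" if "i \<ge> 1" for i using obs[OF that] by (auto simp: PoissonFam)
    have c: "0 < c" "\<And>i. i \<ge> 1 \<Longrightarrow> c \<le> \<tau> i" using reg INF_le pos by (auto simp: PoissonFam c_def)
    show ?thesis
    proof (rule witness[of c "1 / c + 2"])
      show "0 < c" by fact
      show "0 < \<tau> i" "c \<le> \<tau> i + nu2 F" if "i \<ge> 1" for i using pos c that by (simp_all add: PoissonFam)
      show "moments_up_to_four M (Y i) (\<theta> i) (var_fun F (\<theta> i) / \<tau> i) ((1 / c + 2) * (1 + \<bar>\<theta> i\<bar>))" if "i \<ge> 1" for i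
        using poisson_moments[OF M _ c(1) c(2)[OF that], of "\<xi> i" "Y i"] obs[OF that] \<theta>[OF that]
        by (simp only: PoissonFam family_mean.simps)
      have "\<bar>(1 + \<bar>\<theta> i\<bar>) ^ 3\<bar> \<le> 8 * (1 + (\<xi> i) ^ 3)" if "i \<ge> 1" for i
        using \<theta>[OF that] pos(2)[OF that] one_plus_cube_le(1)[of "\<bar>\<theta> i\<bar>"] by (simp add: PoissonFam)
      then show "(\<lambda>p. \<Sum>i=1..p. (1 + \<bar>\<theta> i\<bar>) ^ 3) \<in> O(\<lambda>p. real p)"
      proof (rule sum_bigo_of_termwise_bound)
        show "(\<lambda>p. \<Sum>i=1..p. (\<xi> i) ^ 3) \<in> O(\<lambda>p. real p)"
          using reg unfolding PoissonFam nef_regular.simps by (elim conjE)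
      qed
    qed
  next
    case NegBinomialFam
    have one: "1 \<le> \<tau> i" if "i \<ge> 1" for i using obs[OF that] by (auto simp: NegBinomialFam)
    show ?thesis
    proof (rule witness[of 1 8])
      show "0 < \<tau> i" "1 \<le> \<tau> i + nu2 F" if "i \<ge> 1" for i using one[OF that] by (simp_all add: NegBinomialFam)
      show "moments_up_to_four M (Y i) (\<theta> i) (var_fun F (\<theta> i) / \<tau> i) (8 * (1 + \<bar>\<theta> i\<bar>))" if "i \<ge> 1" for i
        using neg_binomial_moments[OF M, of "\<tau> i" "\<xi> i" "Y i"] obs[OF that] \<theta>[OF that]
        by (simp only: NegBinomialFam family_mean.simps)
      have "\<bar>(1 + \<bar>\<theta> i\<bar>) ^ 3\<bar> \<le> 8 * (1 + (\<xi> i / (1 - \<xi> i)) ^ 4)" if "i \<ge> 1" for i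
        using abs_one_plus_abs_cube_le[of "\<theta> i"] \<theta>[OF that] by (simp only: NegBinomialFam family_mean.simps)
      then show "(\<lambda>p. \<Sum>i=1..p. (1 + \<bar>\<theta> i\<bar>) ^ 3) \<in> O(\<lambda>p. real p)"
      proof (rule sum_bigo_of_termwise_bound)
        show "(\<lambda>p. \<Sum>i=1..p. (\<xi> i / (1 - \<xi> i)) ^ 4) \<in> O(\<lambda>p. real p)"
          using reg unfolding NegBinomialFam nef_regular.simps by (elim conjE)
      qed
    qed simp
  next
    case (GammaFam \<alpha>)
    define c where "c = (INF i\<in>{1..}. \<tau> i)"
    have pos: "0 < \<tau> i" if "i \<ge> 1" for i using obs[OF that] by (auto simp: GammaFam)
    have \<alpha>: "0 < \<alpha>" using obs[of 1] by (simp add: GammaFam)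
    have c: "0 < c" "\<And>i. i \<ge> 1 \<Longrightarrow> c \<le> \<tau> i" using reg INF_le pos by (auto simp: GammaFam c_def)
    show ?thesis
    proof (rule witness[of c "2 * (1 / c + \<alpha>) * (1 + 1 / \<alpha>)"])
      show "0 < c" by fact
      show "0 < \<tau> i" "c \<le> \<tau> i + nu2 F" if "i \<ge> 1" for i
        using pos[OF that] c(2)[OF that] \<alpha> by (simp_all add: GammaFam add_increasing2)
      show "moments_up_to_four M (Y i) (\<theta> i) (var_fun F (\<theta> i) / \<tau> i)
          (2 * (1 / c + \<alpha>) * (1 + 1 / \<alpha>) * (1 + \<bar>\<theta> i\<bar>))" if "i \<ge> 1" for i
        using gamma_moments[OF M _ c(1) c(2)[OF that], of \<alpha> "\<xi> i" "Y i"] obs[OF that] \<theta>[OF that]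
        by (simp only: GammaFam family_mean.simps)
      have "\<bar>(1 + \<bar>\<theta> i\<bar>) ^ 3\<bar> \<le> 8 * (1 + \<alpha> ^ 4) * (1 + (\<xi> i) ^ 4)" if "i \<ge> 1" for i
      proof -
        have "\<bar>(1 + \<bar>\<theta> i\<bar>) ^ 3\<bar> \<le> 8 * (1 + \<alpha> ^ 4 * (\<xi> i) ^ 4)"
          using abs_one_plus_abs_cube_le[of "\<theta> i"] \<theta>[OF that]
          by (simp only: GammaFam family_mean.simps power_mult_distrib)
        also have "\<dots> \<le> 8 * (1 + \<alpha> ^ 4) * (1 + (\<xi> i) ^ 4)" by (simp add: algebra_simps)
        finally show ?thesis .
      qed
      then show "(\<lambda>p. \<Sum>i=1..p. (1 + \<bar>\<theta> i\<bar>) ^ 3) \<in> O(\<lambda>p. real p)"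
      proof (rule sum_bigo_of_termwise_bound)
        show "(\<lambda>p. \<Sum>i=1..p. (\<xi> i) ^ 4) \<in> O(\<lambda>p. real p)"
          using reg unfolding GammaFam nef_regular.simps by (elim conjE)
      qed
    qed
  next
    case (GHSFam \<alpha>)
    define c where "c = (INF i\<in>{1..}. \<tau> i)"
    have pos: "0 < \<tau> i" if "i \<ge> 1" for i using obs[OF that] by (auto simp: GHSFam)
    have \<alpha>: "0 < \<alpha>" using obs[of 1] by (simp add: GHSFam)
    have c: "0 < c" "\<And>i. i \<ge> 1 \<Longrightarrow> c \<le> \<tau> i" using reg INF_le pos by (auto simp: GHSFam c_def)
    show ?thesis
    proof (rule witness[of c "2 * (1 / c + \<alpha>) * (1 + 1 / \<alpha>)"])
      show "0 < c" by fact
      show "0 < \<tau> i" "c \<le> \<tau> i + nu2 F" if "i \<ge> 1" for i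
        using pos[OF that] c(2)[OF that] \<alpha> by (simp_all add: GHSFam add_increasing2)
      show "moments_up_to_four M (Y i) (\<theta> i) (var_fun F (\<theta> i) / \<tau> i)
          (2 * (1 / c + \<alpha>) * (1 + 1 / \<alpha>) * (1 + \<bar>\<theta> i\<bar>))" if "i \<ge> 1" for i
        using GHS_moments[OF M _ c(1) c(2)[OF that], of \<alpha> "\<xi> i" "Y i"] obs[OF that] \<theta>[OF that]
        by (simp only: GHSFam family_mean.simps)
      have "\<bar>(1 + \<bar>\<theta> i\<bar>) ^ 3\<bar> \<le> 8 * (1 + \<alpha> ^ 4) * (1 + (\<xi> i) ^ 4)" if "i \<ge> 1" for i
      proof -
        have "\<bar>(1 + \<bar>\<theta> i\<bar>) ^ 3\<bar> \<le> 8 * (1 + \<alpha> ^ 4 * (\<xi> i) ^ 4)"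
          using abs_one_plus_abs_cube_le[of "\<theta> i"] \<theta>[OF that]
          by (simp only: GHSFam family_mean.simps power_mult_distrib)
        also have "\<dots> \<le> 8 * (1 + \<alpha> ^ 4) * (1 + (\<xi> i) ^ 4)" by (simp add: algebra_simps)
        finally show ?thesis .
      qed
      then show "(\<lambda>p. \<Sum>i=1..p. (1 + \<bar>\<theta> i\<bar>) ^ 3) \<in> O(\<lambda>p. real p)"
      proof (rule sum_bigo_of_termwise_bound)
        show "(\<lambda>p. \<Sum>i=1..p. (\<xi> i) ^ 4) \<in> O(\<lambda>p. real p)"
          using reg unfolding GHSFam nef_regular.simps by (elim conjE)
      qed
    qed
  qed
qed

section \<open>Comparison of losses and risks\<close>

lemma (in prob_space) shrinkage_loss_integrable:
  fixes Y :: "nat \<Rightarrow> 'a \<Rightarrow> real" and \<tau> \<theta> :: "nat \<Rightarrow> real" and g :: "'a \<Rightarrow> ennreal"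
  assumes Y: "\<And>i. i \<in> {1..p} \<Longrightarrow> Y i \<in> borel_measurable M"
    and Y2: "\<And>i. i \<in> {1..p} \<Longrightarrow> integrable M (\<lambda>\<omega>. (Y i \<omega>)\<^sup>2)"
    and \<tau>: "\<And>i. i \<in> {1..p} \<Longrightarrow> 0 < \<tau> i" and g[measurable]: "g \<in> borel_measurable M"
  shows "integrable M (\<lambda>\<omega>. sq_loss p \<theta> (shrink_gm \<tau> p (g \<omega>) (\<lambda>i. Y i \<omega>)))"
proof -
  define m where "m \<omega> = grand_mean p (\<lambda>i. Y i \<omega>)" for \<omega>
  have m[measurable]: "m \<in> borel_measurable M"
    unfolding m_def grand_mean_def using Y by (intro borel_measurable_divide borel_measurable_sum) auto
  have m2: "integrable M (\<lambda>\<omega>. (m \<omega>)\<^sup>2)"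
    unfolding m_def grand_mean_def power_divide
    using integrable_square_sum[of "{1..p}" Y M] Y Y2 by auto
  have w[measurable]: "(\<lambda>\<omega>. mean_weight t (g \<omega>)) \<in> borel_measurable M" "(\<lambda>\<omega>. obs_weight t (g \<omega>)) \<in> borel_measurable M" for t
    unfolding mean_weight_def obs_weight_def by measurable
  have "integrable M (\<lambda>\<omega>. (shrink_gm \<tau> p (g \<omega>) (\<lambda>i. Y i \<omega>) i - \<theta> i)\<^sup>2)" if i: "i \<in> {1..p}" for i
  proof (rule Bochner_Integration.integrable_bound)
    note [measurable] = Y[OF i]
    show "(\<lambda>\<omega>. (shrink_gm \<tau> p (g \<omega>) (\<lambda>i. Y i \<omega>) i - \<theta> i)\<^sup>2) \<in> borel_measurable M"
      unfolding shrink_gm_def m_def[symmetric] by measurable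
    show "integrable M (\<lambda>\<omega>. (\<bar>Y i \<omega>\<bar> + \<bar>m \<omega>\<bar> + \<bar>\<theta> i\<bar>)\<^sup>2)"
      using Y2[OF i] m2 by (intro integrable_square_add) auto
    have "\<bar>shrink_gm \<tau> p (g \<omega>) (\<lambda>i. Y i \<omega>) i - \<theta> i\<bar> \<le> \<bar>Y i \<omega>\<bar> + \<bar>m \<omega>\<bar> + \<bar>\<theta> i\<bar>" for \<omega>
    proof -
      let ?w = "mean_weight (\<tau> i) (g \<omega>)"
      have w: "0 \<le> ?w" "?w \<le> 1" using mean_weight_range[OF \<tau>[OF i]] by auto
      have "\<bar>(1 - ?w) * Y i \<omega>\<bar> \<le> \<bar>Y i \<omega>\<bar>" "\<bar>?w * m \<omega>\<bar> \<le> \<bar>m \<omega>\<bar>"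
        using w by (auto simp: abs_mult intro!: mult_left_le_one_le)
      then show ?thesis
        unfolding shrink_gm_def m_def[symmetric] obs_weight_eq[OF \<tau>[OF i]] by linarith
    qed
    from power_mono[OF this abs_ge_zero, of _ 2]
    show "AE \<omega> in M. norm ((shrink_gm \<tau> p (g \<omega>) (\<lambda>i. Y i \<omega>) i - \<theta> i)\<^sup>2)
        \<le> norm ((\<bar>Y i \<omega>\<bar> + \<bar>m \<omega>\<bar> + \<bar>\<theta> i\<bar>)\<^sup>2)" by simp
  qed
  then show ?thesis
    unfolding sq_loss_def by (intro integrable_divide Bochner_Integration.integrable_sum)
qed

theorem theorem4p9:
  fixes M :: "'a measure"
    and F :: nef_qvf
    and Y :: "nat \<Rightarrow> 'a \<Rightarrow> real"
    and \<tau> \<xi> \<theta> :: "nat \<Rightarrow> real"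
    and gPG gam :: "nat \<Rightarrow> 'a \<Rightarrow> ennreal"
  assumes "prob_space M"
    and "prob_space.indep_vars M (\<lambda>_. borel) Y {1..}"
    and "\<And>i. i \<ge> 1 \<Longrightarrow> nef_obs F M (\<tau> i) (\<xi> i) (Y i)"
    and "\<And>i. i \<ge> 1 \<Longrightarrow> \<theta> i = family_mean F (\<xi> i)"
    and "nef_regular F \<tau> \<xi>"
    and "\<And>p. p \<ge> 1 \<Longrightarrow> gPG p \<in> borel_measurable M"
    and "\<And>p \<omega> g. p \<ge> 1 \<Longrightarrow> \<omega> \<in> space M \<Longrightarrow>
           URE_PG F \<tau> p (\<lambda>i. Y i \<omega>) (gPG p \<omega>) \<le> URE_PG F \<tau> p (\<lambda>i. Y i \<omega>) g"
    and "\<And>p. p \<ge> 1 \<Longrightarrow> gam p \<in> borel_measurable M"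
  shows "(\<forall>\<epsilon>>0.
            (\<lambda>p. measure M {\<omega> \<in> space M.
                   sq_loss p \<theta> (shrink_gm \<tau> p (gPG p \<omega>) (\<lambda>i. Y i \<omega>))
                     \<ge> sq_loss p \<theta> (shrink_gm \<tau> p (gam p \<omega>) (\<lambda>i. Y i \<omega>)) + \<epsilon>})
              \<longlonglongrightarrow> 0) \<and>
         limsup (\<lambda>p. ereal
            (sq_risk M p \<theta> (\<lambda>\<omega>. shrink_gm \<tau> p (gPG p \<omega>) (\<lambda>i. Y i \<omega>))
              - sq_risk M p \<theta> (\<lambda>\<omega>. shrink_gm \<tau> p (gam p \<omega>) (\<lambda>i. Y i \<omega>)))) \<le> 0"
proof -
  interpret prob_space M by fact
  define lPG where "lPG p \<omega> = sq_loss p \<theta> (shrink_gm \<tau> p (gPG p \<omega>) (\<lambda>i. Y i \<omega>))" for p \<omega>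
  define lgam where "lgam p \<omega> = sq_loss p \<theta> (shrink_gm \<tau> p (gam p \<omega>) (\<lambda>i. Y i \<omega>))" for p \<omega>
  have "\<exists>c C. 0 < c \<and> (\<forall>i\<ge>1. 0 < \<tau> i \<and> c \<le> \<tau> i + nu2 F) \<and>
      (\<forall>i\<ge>1. moments_up_to_four M (Y i) (\<theta> i) (var_fun F (\<theta> i) / \<tau> i) (C * (1 + \<bar>\<theta> i\<bar>))) \<and>
      (\<lambda>p. \<Sum>i=1..p. (1 + \<bar>\<theta> i\<bar>) ^ 3) \<in> O(\<lambda>p. real p)"
    by (rule nef_regular_uniform_moments[OF assms(1,3,4,5)])
  then obtain c C where cC: "0 < c \<and> (\<forall>i\<ge>1. 0 < \<tau> i \<and> c \<le> \<tau> i + nu2 F) \<and>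
      (\<forall>i\<ge>1. moments_up_to_four M (Y i) (\<theta> i) (var_fun F (\<theta> i) / \<tau> i) (C * (1 + \<bar>\<theta> i\<bar>))) \<and>
      (\<lambda>p. \<Sum>i=1..p. (1 + \<bar>\<theta> i\<bar>) ^ 3) \<in> O(\<lambda>p. real p)"
    by (elim exE) (rule that)
  from cC have growth: "(\<lambda>p. \<Sum>i=1..p. (1 + \<bar>\<theta> i\<bar>) ^ 3) \<in> O(\<lambda>p. real p)" by (elim conjE)
  from cC have c: "0 < c" by (elim conjE)
  from cC have "\<forall>i\<ge>1. 0 < \<tau> i \<and> c \<le> \<tau> i + nu2 F" by (elim conjE)
  then have \<tau>: "0 < \<tau> i" and tau_c: "c \<le> \<tau> i + nu2 F" if "i \<ge> 1" for i using that by blast+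
  from cC have "\<forall>i\<ge>1. moments_up_to_four M (Y i) (\<theta> i) (var_fun F (\<theta> i) / \<tau> i) (C * (1 + \<bar>\<theta> i\<bar>))"
    by (elim conjE)
  then have mom: "moments_up_to_four M (Y i) (\<theta> i) (var_fun F (\<theta> i) / \<tau> i) (C * (1 + \<bar>\<theta> i\<bar>))"
    if "i \<ge> 1" for i using that by blast
  have Y: "Y i \<in> borel_measurable M" and Y4: "integrable M (\<lambda>\<omega>. (Y i \<omega>) ^ 4)"
    and EY: "expectation (Y i) = \<theta> i"
    and EY2: "expectation (\<lambda>\<omega>. (Y i \<omega>)\<^sup>2) = (\<theta> i)\<^sup>2 + var_fun F (\<theta> i) / \<tau> i"
    and EY4: "expectation (\<lambda>\<omega>. (Y i \<omega>) ^ 4) \<le> 144 * (C * (1 + \<bar>\<theta> i\<bar>)) ^ 4" if "i \<ge> 1" for i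
    using mom[OF that] unfolding moments_up_to_four_def by blast+
  have Y2: "integrable M (\<lambda>\<omega>. (Y i \<omega>)\<^sup>2)" if "i \<ge> 1" for i
  proof (rule square_integrable_imp_integrable)
    show "(\<lambda>\<omega>. (Y i \<omega>)\<^sup>2) \<in> borel_measurable M" using Y[OF that] by measurable
    show "integrable M (\<lambda>\<omega>. ((Y i \<omega>)\<^sup>2)\<^sup>2)" using Y4[OF that] by simp
  qed
  define b where "b p = (\<Sum>i=1..p. expectation (\<lambda>\<omega>. (Y i \<omega>) ^ 4))" for p
  have b0: "(\<lambda>p. b p / (real p)\<^sup>2) \<longlonglongrightarrow> 0"
  proof (rule tendsto_sandwich[OF _ _ tendsto_const])
    show "(\<lambda>p. 144 * C ^ 4 * ((\<Sum>i=1..p. (1 + \<bar>\<theta> i\<bar>) ^ 4) / (real p)\<^sup>2)) \<longlonglongrightarrow> 0"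
      using tendsto_mult_left[OF sum_fourth_powers_small[OF _ growth], of "144 * C ^ 4"] by simp
    show "\<forall>\<^sub>F p in sequentially. 0 \<le> b p / (real p)\<^sup>2"
      unfolding b_def by (intro always_eventually allI divide_nonneg_nonneg sum_nonneg Bochner_Integration.integral_nonneg) auto
    show "\<forall>\<^sub>F p in sequentially. b p / (real p)\<^sup>2 \<le> 144 * C ^ 4 * ((\<Sum>i=1..p. (1 + \<bar>\<theta> i\<bar>) ^ 4) / (real p)\<^sup>2)"
    proof (intro always_eventually allI)
      fix p
      have "b p \<le> (\<Sum>i=1..p. 144 * (C * (1 + \<bar>\<theta> i\<bar>)) ^ 4)"
        unfolding b_def by (intro sum_mono EY4) simp
      also have "\<dots> = 144 * C ^ 4 * (\<Sum>i=1..p. (1 + \<bar>\<theta> i\<bar>) ^ 4)"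
        by (simp add: power_mult_distrib sum_distrib_left mult.assoc)
      finally show "b p / (real p)\<^sup>2 \<le> 144 * C ^ 4 * ((\<Sum>i=1..p. (1 + \<bar>\<theta> i\<bar>) ^ 4) / (real p)\<^sup>2)"
        by (simp add: divide_right_mono)
    qed
  qed
  define bounds where "bounds p D \<longleftrightarrow> integrable M D \<and>
      expectation D \<le> URE_error_bound (plug_in_coeff F c) p (b p) \<and>
      (\<forall>\<omega> g. \<bar>URE_PG F \<tau> p (\<lambda>i. Y i \<omega>) g - sq_loss p \<theta> (shrink_gm \<tau> p g (\<lambda>i. Y i \<omega>))\<bar> \<le> D \<omega>)"
    for p :: nat and D
  have "\<exists>D. bounds p D" if p: "1 \<le> p" for p :: nat
  proof -
    have ind: "indep_vars (\<lambda>_. borel) Y {1..p}" by (rule indep_vars_subset[OF assms(2)]) auto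
    show ?thesis
    proof (rule URE_uniformly_close_to_loss[OF p ind, of \<theta> F \<tau> c])
      fix D assume "integrable M D"
        "expectation D \<le> URE_error_bound (plug_in_coeff F c) p (\<Sum>i=1..p. expectation (\<lambda>\<omega>. (Y i \<omega>) ^ 4))"
        "\<And>\<omega> g. \<bar>URE_PG F \<tau> p (\<lambda>i. Y i \<omega>) g - sq_loss p \<theta> (shrink_gm \<tau> p g (\<lambda>i. Y i \<omega>))\<bar> \<le> D \<omega>"
      then have "bounds p D" unfolding bounds_def b_def by (intro conjI allI)
      then show ?thesis by (rule exI[of "bounds p" D])
    next
      fix i assume "i \<in> {1..p}"
      then have i: "i \<ge> 1" by simp
      show "integrable M (\<lambda>\<omega>. (Y i \<omega>) ^ 4)" by (rule Y4[OF i])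
      show "expectation (Y i) = \<theta> i" by (rule EY[OF i])
      show "expectation (\<lambda>\<omega>. (Y i \<omega>)\<^sup>2) = (\<theta> i)\<^sup>2 + var_fun F (\<theta> i) / \<tau> i" by (rule EY2[OF i])
      show "0 < \<tau> i" by (rule \<tau>[OF i])
      show "c \<le> \<tau> i + nu2 F" by (rule tau_c[OF i])
    qed (rule c)
  qed
  then obtain D where "\<And>p. 1 \<le> p \<Longrightarrow> bounds p (D p)" by metis
  then have D: "integrable M (D p)"
    and ED: "expectation (D p) \<le> URE_error_bound (plug_in_coeff F c) p (b p)"
    and close: "\<bar>URE_PG F \<tau> p (\<lambda>i. Y i \<omega>) g - sq_loss p \<theta> (shrink_gm \<tau> p g (\<lambda>i. Y i \<omega>))\<bar> \<le> D p \<omega>"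
    if "1 \<le> p" for p \<omega> g using that unfolding bounds_def by simp_all
  have D0: "0 \<le> D p \<omega>" if "1 \<le> p" for p \<omega> using order_trans[OF abs_ge_zero close[OF that]] .
  have ED_lim: "(\<lambda>p. expectation (D p)) \<longlonglongrightarrow> 0"
  proof (rule tendsto_sandwich[OF _ _ tendsto_const URE_error_bound_tendsto_0[OF b0]])
    show "\<forall>\<^sub>F p in sequentially. 0 \<le> expectation (D p)"
      using eventually_ge_at_top[of 1] by eventually_elim (simp add: D0)
    show "\<forall>\<^sub>F p in sequentially. expectation (D p) \<le> URE_error_bound (plug_in_coeff F c) (real p) (b p)"
      using eventually_ge_at_top[of 1] by eventually_elim (rule ED)
  qed
  \<comment> \<open>The minimizer wins on the risk estimate, which differs from the loss by at most \<open>D p\<close> on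
    either side.\<close>
  have key: "lPG p \<omega> \<le> lgam p \<omega> + 2 * D p \<omega>" if p: "1 \<le> p" and \<omega>: "\<omega> \<in> space M" for p \<omega>
    using assms(7)[OF p \<omega>, of "gam p \<omega>"] close[OF p, of \<omega> "gPG p \<omega>"] close[OF p, of \<omega> "gam p \<omega>"]
    unfolding lPG_def lgam_def by linarith
  have int: "integrable M (lPG p)" "integrable M (lgam p)" if p: "1 \<le> p" for p
    unfolding lPG_def lgam_def
    by (rule shrinkage_loss_integrable; simp add: Y Y2 \<tau> assms(6,8)[OF p])+
  have "(\<lambda>p. measure M {\<omega> \<in> space M. lPG p \<omega> \<ge> lgam p \<omega> + \<epsilon>}) \<longlonglongrightarrow> 0" if \<epsilon>: "0 < \<epsilon>" for \<epsilon>
  proof (rule tendsto_sandwich[OF _ _ tendsto_const])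
    show "(\<lambda>p. expectation (D p) / (\<epsilon> / 2)) \<longlonglongrightarrow> 0" using tendsto_divide[OF ED_lim tendsto_const, of "\<epsilon> / 2"] \<epsilon> by simp
    show "\<forall>\<^sub>F p in sequentially. measure M {\<omega> \<in> space M. lPG p \<omega> \<ge> lgam p \<omega> + \<epsilon>} \<le> expectation (D p) / (\<epsilon> / 2)"
      using eventually_ge_at_top[of 1]
    proof eventually_elim
      case (elim p)
      note [measurable] = borel_measurable_integrable[OF D[OF elim]]
      have "measure M {\<omega> \<in> space M. lPG p \<omega> \<ge> lgam p \<omega> + \<epsilon>} \<le> measure M {\<omega> \<in> space M. D p \<omega> \<ge> \<epsilon> / 2}"
        using key[OF elim] by (intro finite_measure_mono) (fastforce, measurable)
      also have "\<dots> \<le> expectation (D p) / (\<epsilon> / 2)"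
        by (rule integral_Markov_inequality_measure[OF D[OF elim] sets.top]) (use D0[OF elim] \<epsilon> in auto)
      finally show ?case .
    qed
  qed auto
  moreover have "limsup (\<lambda>p. ereal (expectation (lPG p) - expectation (lgam p))) \<le> 0"
  proof -
    have "limsup (\<lambda>p. ereal (expectation (lPG p) - expectation (lgam p))) \<le> limsup (\<lambda>p. ereal (2 * expectation (D p)))"
    proof (rule Limsup_mono)
      show "\<forall>\<^sub>F p in sequentially. ereal (expectation (lPG p) - expectation (lgam p)) \<le> ereal (2 * expectation (D p))"
        using eventually_ge_at_top[of 1]
      proof eventually_elim
        case (elim p)
        have "expectation (lPG p) \<le> expectation (\<lambda>\<omega>. lgam p \<omega> + 2 * D p \<omega>)"
          using int[OF elim] D[OF elim] key[OF elim] by (intro integral_mono) auto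
        also have "\<dots> = expectation (lgam p) + 2 * expectation (D p)" using int[OF elim] D[OF elim] by simp
        finally show ?case by simp
      qed
    qed
    also have "\<dots> = ereal (2 * 0)"
      using ED_lim by (intro lim_imp_Limsup tendsto_ereal tendsto_mult_left) auto
    finally show ?thesis by (simp add: zero_ereal_def)
  qed
  ultimately show ?thesis unfolding lPG_def lgam_def sq_risk_def by blast
qed

end
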